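(* Let $c\ge2$, let $\mathcal{G}_1,\ldots,\mathcal{G}_c$ be fixed ordered graphs, each containing at least one edge, let $\boldsymbol{\lambda}=(\lambda_1,\ldots,\lambda_c)\in(0,\infty)^c$, and put $h_i=v(\mathcal{G}_i)$ and $R=\overline{\mathrm{R}}(\mathcal{G}_1,\ldots,\mathcal{G}_c)$. Fix an integer $t\ge R$, and set $J_t=\{i\in[c]:h_i\le t\}$ and $\delta_i=\delta_{h_i}(1/c)$ for $i\in J_t$. Then there exist $\varepsilon,\alpha>0$ and $n_0$ such that, for every $n\ge n_0$, every $c$-edge-coloring $\chi$ of $\mathcal{K}_n$ admits sets (clusters) $W_1<\cdots<W_t$ in $[n]$ with $|W_j|\ge\alpha n$ for all $j\in[t]$, which are pairwise $\varepsilon$-regular, and for which the following holds. Color each reduced edge $W_uW_v$ ($1\le u<v\le t$) by a color $\gamma$ maximizing the density $d_\gamma(W_u,W_v)$. Let $\mathcal{Q}_i$ be the family of order-preserving copies of $\mathcal{G}_i$ all of whose edges have color $i$ in this reduced coloring of the ordered complete graph on $W_1<\cdots<W_t$, and let $T_i^{\mathrm{reg}}$ be the number of color-$i$ order-preserving copies of $\mathcal{G}_i$ in $\mathcal{K}_n$ (under $\chi$) that arise from members of $\mathcal{Q}_i$, meeting every selected cluster in at most one vertex. Then $$T_i^{\mathrm{reg}}\ \ge\ \delta_i\sum_{F\in\mathcal{Q}_i}\ \prod_{W_j\in V(F)}|W_j|\qquad(i\in J_t),$$ and $$\sum_{i\in J_t}\frac{\lambda_iT_i^{\mathrm{reg}}}{\delta_i(\alpha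 n)^{h_i}}\ \ge\ \overline{\mathrm{M}}_{\boldsymbol{\lambda}}(t;\mathcal{G}_1,\ldots,\mathcal{G}_c).$$
   Context: An ordered graph is a finite graph with a linear order on its vertex set; $v(\mathcal{G})$ is its number of vertices. $[c]=\{1,\ldots,c\}$. $\mathcal{K}_n$ is the complete graph on $[n]$ with the natural order. An order-preserving copy of an ordered graph $\mathcal{H}$ in $\mathcal{G}$ is an injective map $V(\mathcal{H})\to V(\mathcal{G})$ that preserves the vertex order and maps every edge of $\mathcal{H}$ to an edge of $\mathcal{G}$; copies are counted by their vertex sets. For $\chi:E(\mathcal{K}_n)\to[c]$, $N_i(\chi;\mathcal{G}_i)$ is the number of order-preserving copies of $\mathcal{G}_i$ in $\mathcal{K}_n$ all of whose edges have color $i$. $\overline{\mathrm{R}}(\mathcal{G}_1,\ldots,\mathcal{G}_c)$ is the least $N$ such that every $c$-edge-coloring of $\mathcal{K}_N$ contains an order-preserving copy of $\mathcal{G}_i$ in color $i$ for some $i\in[c]$, and $$\overline{\mathrm{M}}_{\boldsymbol{\lambda}}(n;\mathcal{G}_1,\ldots,\mathcal{G}_c)=\min_{\chi:E(\mathcal{K}_n)\to[c]}\sum_{i=1}^{c}\lambda_iN_i(\chi;\mathcal{G}_i).$$ Given $\chi:E(\mathcal{K}_n)\to[c]$ and disjoint nonempty $A,B\subseteq[n]$, $d_\gamma(A,B)=e_\gamma(A,B)/(|A||B|)$, where $e_\gamma(A,B)$ is the number of edges of color $\gamma$ between $A$ and $B$. The pair $(A,B)$ is $\varepsilon$-regular if,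 whenever $X\subseteq A$, $Y\subseteq B$ satisfy $|X|\ge\varepsilon|A|$ and $|Y|\ge\varepsilon|B|$, one has $|d_\gamma(X,Y)-d_\gamma(A,B)|\le\varepsilon$ for every $\gamma\in[c]$. $W_1<\cdots<W_t$ means that every element of $W_u$ precedes every element of $W_v$ whenever $u<v$. A copy of $\mathcal{G}_i$ in $\mathcal{K}_n$ arises from $F\in\mathcal{Q}_i$, where $F$ has vertices $W_{a_1}<\cdots<W_{a_{h_i}}$, if for each $\ell\in[h_i]$ the $\ell$-th vertex of the copy lies in $W_{a_\ell}$. The constants $\delta_h(d)$, for $h\ge1$ and $0<d\le1$, are defined recursively by $\delta_1(d)=1$ and $\delta_h(d)=\frac12\,\delta_{h-1}(d/2)\left(\frac d2\right)^{h-1}$ for $h\ge2$. *)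

theory Defs
  imports Complex_Main "HOL-Library.FuncSet"
begin

text \<open>The linear order on the vertices of an ordered graph is the order of the vertex type.\<close>

record 'a ordered_graph =
  verts :: "'a set"
  edges :: "'a set set"

definition ordered_graph :: "'a::linorder ordered_graph \<Rightarrow> bool" where
  "ordered_graph G \<longleftrightarrow> finite (verts G) \<and> edges G \<subseteq> {e. e \<subseteq> verts G \<and> card e = 2}"

definition num_verts :: "'a ordered_graph \<Rightarrow> nat" where
  "num_verts G = card (verts G)"

definition complete_ograph :: "nat \<Rightarrow> nat ordered_graph" where
  "complete_ograph n = \<lparr>verts = {1..n}, edges = {e. e \<subseteq> {1..n} \<and> card e = 2}\<rparr>"

definition order_embedding :: "('a::linorder \<Rightarrow> 'b::linorder) \<Rightarrow> 'a ordered_graph \<Rightarrow> 'b ordered_graph \<Rightarrow> bool" where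
  "order_embedding f H G \<longleftrightarrow> f ` verts H \<subseteq> verts G \<and> inj_on f (verts H) \<and> strict_mono_on (verts H) f
     \<and> (\<forall>e\<in>edges H. f ` e \<in> edges G)"

definition colorings :: "nat \<Rightarrow> nat \<Rightarrow> (nat set \<Rightarrow> nat) set" where
  "colorings n c = edges (complete_ograph n) \<rightarrow>\<^sub>E {1..c}"

text \<open>
  Copies are identified with their vertex sets. An order-preserving embedding of a finite ordered
  graph is determined by its image, so the vertex set also determines the edges of the copy.
\<close>

definition mono_copies :: "(nat set \<Rightarrow> nat) \<Rightarrow> nat \<Rightarrow> nat \<Rightarrow> 'a::linorder ordered_graph \<Rightarrow> nat set set" where
  "mono_copies \<chi> n i G = {f ` verts G | f. order_embedding f G (complete_ograph n) \<and> (\<forall>e\<in>edges G. \<chi> (f ` e) = i)}"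

definition ordered_ramsey :: "nat \<Rightarrow> (nat \<Rightarrow> 'a::linorder ordered_graph) \<Rightarrow> nat" where
  "ordered_ramsey c G =
     (LEAST N. \<forall>\<chi>\<in>colorings N c. \<exists>i\<in>{1..c}. mono_copies \<chi> N i (G i) \<noteq> {})"

definition ordered_multiplicity ::
    "(nat \<Rightarrow> real) \<Rightarrow> nat \<Rightarrow> nat \<Rightarrow> (nat \<Rightarrow> 'a::linorder ordered_graph) \<Rightarrow> real" where
  "ordered_multiplicity lam n c G =
     (MIN \<chi>\<in>colorings n c. \<Sum>i\<in>{1..c}. lam i * real (card (mono_copies \<chi> n i (G i))))"

definition edge_count :: "(nat set \<Rightarrow> nat) \<Rightarrow> nat \<Rightarrow> nat set \<Rightarrow> nat set \<Rightarrow> nat" where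
  "edge_count \<chi> \<gamma> A B = card {{a, b} | a b. a \<in> A \<and> b \<in> B \<and> \<chi> {a, b} = \<gamma>}"

definition edge_density :: "(nat set \<Rightarrow> nat) \<Rightarrow> nat \<Rightarrow> nat set \<Rightarrow> nat set \<Rightarrow> real" where
  "edge_density \<chi> \<gamma> A B = real (edge_count \<chi> \<gamma> A B) / (real (card A) * real (card B))"

definition regular_pair :: "(nat set \<Rightarrow> nat) \<Rightarrow> nat \<Rightarrow> real \<Rightarrow> nat set \<Rightarrow> nat set \<Rightarrow> bool" where
  "regular_pair \<chi> c \<epsilon> A B \<longleftrightarrow>
     (\<forall>X Y. X \<subseteq> A \<and> Y \<subseteq> B \<and> real (card X) \<ge> \<epsilon> * real (card A) \<and> real (card Y) \<ge> \<epsilon> * real (card B) \<longrightarrow>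
        (\<forall>\<gamma>\<in>{1..c}. \<bar>edge_density \<chi> \<gamma> X Y - edge_density \<chi> \<gamma> A B\<bar> \<le> \<epsilon>))"

text \<open>
  The ordered complete graph on the clusters \<open>W 1 < \<dots> < W t\<close> is represented by \<open>complete_ograph t\<close>, with
  vertex \<open>u\<close> standing for \<open>W u\<close>. Ties for the maximum density may be broken arbitrarily, so the
  reduced coloring is a predicate on \<open>\<rho>\<close>.
\<close>

definition reduced_coloring ::
    "(nat set \<Rightarrow> nat) \<Rightarrow> nat \<Rightarrow> nat \<Rightarrow> (nat \<Rightarrow> nat set) \<Rightarrow> (nat set \<Rightarrow> nat) \<Rightarrow> bool" where
  "reduced_coloring \<chi> c t W \<rho> \<longleftrightarrow> \<rho> \<in> colorings t c \<and>
     (\<forall>u v. 1 \<le> u \<and> u < v \<and> v \<le> t \<longrightarrow>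
        (\<forall>\<gamma>\<in>{1..c}. edge_density \<chi> \<gamma> (W u) (W v) \<le> edge_density \<chi> (\<rho> {u, v}) (W u) (W v)))"

definition arises_from :: "(nat \<Rightarrow> nat set) \<Rightarrow> nat set \<Rightarrow> nat set \<Rightarrow> bool" where
  "arises_from W C F \<longleftrightarrow> card C = card F \<and>
     (\<forall>l<card F. sorted_list_of_set C ! l \<in> W (sorted_list_of_set F ! l))"

definition regular_copies ::
    "(nat set \<Rightarrow> nat) \<Rightarrow> nat \<Rightarrow> (nat \<Rightarrow> nat set) \<Rightarrow> nat \<Rightarrow> (nat set \<Rightarrow> nat) \<Rightarrow> nat \<Rightarrow>
     'a::linorder ordered_graph \<Rightarrow> nat set set" where
  "regular_copies \<chi> n W t \<rho> i G =
     {C \<in> mono_copies \<chi> n i G. (\<exists>F\<in>mono_copies \<rho> t i G. arises_from W C F) \<and>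
        (\<forall>j\<in>{1..t}. card (C \<inter> W j) \<le> 1)}"

text \<open>The index of \<open>delta\<close> starts at 1; the value at 0 is a dummy.\<close>

fun delta :: "nat \<Rightarrow> real \<Rightarrow> real" where
  "delta 0 d = 1"
| "delta (Suc 0) d = 1"
| "delta (Suc (Suc h)) d = 1 / 2 * delta (Suc h) (d / 2) * (d / 2) ^ Suc h"

end

theory Submission
  imports Defs
begin

text \<open>
  Szemeredi's regularity lemma is not needed, because only \<open>t\<close> clusters have to be found and not a
  whole partition. In a single pair, passing repeatedly to subsets of proportion \<open>\<eta>\<close> on which the density
  of one color rises by more than \<open>\<eta>\<close> stops after at most \<open>1 / \<eta>\<close> steps; on the resulting pair
  no large subpair is much denser than average, and since densities average out over a pair, no large
  subpair is much sparser either. Regularity passes to large subsets, so starting from \<open>t\<close> consecutive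
  intervals one can treat all pairs and colors one after the other. The densest color of a pair has
  density at least \<open>1 / c\<close>, and the copies are then counted by embedding one vertex at a time: at
  least half of the vertices of a cluster have degree at least \<open>d / 2\<close> times the size of the other
  clusters, which is the recursion defining \<open>delta\<close>.
\<close>

section \<open>Counts and densities of pairs for one color class\<close>

text \<open>A color class is encoded as a predicate on doubletons, to be instantiated with
  \<open>\<lambda>e. \<chi> e = \<gamma>\<close>. The double sum of indicators makes splitting or
  swapping the sides a manipulation of sums.\<close>

definition pair_count :: "('b set \<Rightarrow> bool) \<Rightarrow> 'b set \<Rightarrow> 'b set \<Rightarrow> real" where
  "pair_count R A B = (\<Sum>a\<in>A. \<Sum>b\<in>B. of_bool (R {a, b}))"

definition pair_density :: "('b set \<Rightarrow> bool) \<Rightarrow> 'b set \<Rightarrow> 'b set \<Rightarrow> real" where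
  "pair_density R A B = pair_count R A B / (real (card A) * real (card B))"

text \<open>The one-color version of \<open>regular_pair\<close>, so that pairs and colors can be
  treated one at a time.\<close>

definition uniform_pair :: "('b set \<Rightarrow> bool) \<Rightarrow> real \<Rightarrow> 'b set \<Rightarrow> 'b set \<Rightarrow> bool" where
  "uniform_pair R \<epsilon> A B \<longleftrightarrow>
     (\<forall>X Y. X \<subseteq> A \<longrightarrow> Y \<subseteq> B \<longrightarrow> \<epsilon> * card A \<le> card X \<longrightarrow> \<epsilon> * card B \<le> card Y \<longrightarrow>
        \<bar>pair_density R X Y - pair_density R A B\<bar> \<le> \<epsilon>)"

lemma pair_count_nonneg: "0 \<le> pair_count R A B"
  by (simp add: pair_count_def sum_nonneg)

lemma pair_count_le: "pair_count R A B \<le> real (card A) * real (card B)"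
proof -
  have "pair_count R A B \<le> (\<Sum>a\<in>A. \<Sum>b\<in>B. 1)"
    unfolding pair_count_def by (intro sum_mono) simp
  then show ?thesis by simp
qed

lemma pair_count_commute: "pair_count R A B = pair_count R B A"
  unfolding pair_count_def by (subst sum.swap) (simp add: insert_commute)

lemma pair_count_diff_left:
  "finite A \<Longrightarrow> X \<subseteq> A \<Longrightarrow> pair_count R A B = pair_count R X B + pair_count R (A - X) B"
  unfolding pair_count_def by (simp add: sum.subset_diff add.commute)

lemma pair_count_diff_right:
  "finite B \<Longrightarrow> Y \<subseteq> B \<Longrightarrow> pair_count R A B = pair_count R A Y + pair_count R A (B - Y)"
  using pair_count_diff_left[of B Y R A] by (simp add: pair_count_commute)

text \<open>In the degenerate case the density is 0 by division by zero; the count, squeezed between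
  0 and the product of the sizes, vanishes as well.\<close>

lemma pair_count_eq_density:
  "pair_count R A B = pair_density R A B * (real (card A) * real (card B))"
proof (cases "real (card A) * real (card B) = 0")
  case True
  then show ?thesis
    using pair_count_le[of R A B] pair_count_nonneg[of R A B] by (simp only: mult_zero_right)
qed (simp add: pair_density_def)

lemma pair_density_nonneg: "0 \<le> pair_density R A B"
  by (simp add: pair_density_def pair_count_nonneg)

lemma pair_density_le_1: "pair_density R A B \<le> 1"
proof (cases "real (card A) * real (card B) = 0")
  case False
  then have "0 < real (card A) * real (card B)" by simp
  then show ?thesis
    using pair_count_le[of R A B] by (simp only: pair_density_def divide_le_eq_1_pos)
qed (auto simp: pair_density_def)

section \<open>Uniform subpairs by density increment\<close>

text \<open>Otherwise every pair reached could be replaced by a subpair denser by more than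
  \<open>\<eta>\<close>, and after \<open>K\<close> replacements the density would exceed 1.\<close>

lemma upper_uniform_subpair:
  fixes \<eta> :: real and A B :: "'b set"
  assumes \<eta>: "0 < \<eta>" "1 < \<eta> * real K" and \<eta>1: "\<eta> \<le> 1"
  shows "\<exists>X Y. X \<subseteq> A \<and> Y \<subseteq> B \<and> \<eta> ^ K * card A \<le> card X \<and> \<eta> ^ K * card B \<le> card Y \<and>
           (\<forall>U V. U \<subseteq> X \<longrightarrow> V \<subseteq> Y \<longrightarrow> \<eta> * card X \<le> card U \<longrightarrow> \<eta> * card Y \<le> card V \<longrightarrow>
              pair_density R U V \<le> pair_density R X Y + \<eta>)"
proof (rule ccontr)
  assume neg: "\<not> ?thesis"
  \<comment> \<open>Invariant after \<open>k\<close> replacements: each side has lost at most a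
    factor \<open>\<eta> ^ k\<close>, and the density has reached \<open>\<eta> * k\<close>.\<close>
  have "\<exists>X Y. X \<subseteq> A \<and> Y \<subseteq> B \<and> \<eta> ^ k * card A \<le> card X \<and> \<eta> ^ k * card B \<le> card Y \<and>
          \<eta> * k \<le> pair_density R X Y" if "k \<le> K" for k
    using that
  proof (induction k)
    case 0
    then show ?case using pair_density_nonneg by (intro exI[of _ A] exI[of _ B]) auto
  next
    case (Suc k)
    then obtain X Y where XY: "X \<subseteq> A" "Y \<subseteq> B" "\<eta> ^ k * card A \<le> card X" "\<eta> ^ k * card B \<le> card Y"
      "\<eta> * k \<le> pair_density R X Y" by auto
    \<comment> \<open>The negated claim yields a denser subpair only for pairs that retain an
      \<open>\<eta> ^ K\<close> fraction of \<open>A\<close> and \<open>B\<close>; after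
      \<open>k \<le> K\<close> replacements this is still the case.\<close>
    have "\<eta> ^ K \<le> \<eta> ^ k"
      using Suc.prems \<eta>1 \<eta>(1) by (intro power_decreasing) auto
    then have "\<eta> ^ K * card A \<le> card X" "\<eta> ^ K * card B \<le> card Y"
      using XY(3,4) by (meson mult_right_mono of_nat_0_le_iff order_trans)+
    then obtain U V where UV: "U \<subseteq> X" "V \<subseteq> Y" "\<eta> * card X \<le> card U" "\<eta> * card Y \<le> card V"
      "pair_density R X Y + \<eta> < pair_density R U V"
      using neg XY(1,2) by (meson not_le)
    have "\<eta> ^ Suc k * card A \<le> card U" "\<eta> ^ Suc k * card B \<le> card V"
      using UV(3,4) mult_left_mono[OF XY(3) less_imp_le[OF \<eta>(1)]]
        mult_left_mono[OF XY(4) less_imp_le[OF \<eta>(1)]]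
      unfolding power_Suc mult.assoc by linarith+
    then show ?case
      using UV XY by (intro exI[of _ U] exI[of _ V]) (auto simp: algebra_simps)
  qed
  from this[of K] obtain X Y where "\<eta> * K \<le> pair_density R X Y" by auto
  then show False using pair_density_le_1[of R X Y] \<eta>(2) by linarith
qed

text \<open>The one-sided bound, with \<open>\<eta>\<close> far below \<open>\<epsilon>\<close>, is
  applied to the two rectangles that complete \<open>U \<times> V\<close> to
  \<open>X \<times> Y\<close>; this turns it into a lower bound for \<open>U, V\<close>. The number
  of increments depends on \<open>\<epsilon>\<close> only, hence so does
  \<open>\<beta>\<close>.\<close>

lemma uniform_subpair:
  fixes \<epsilon> :: real
  assumes "0 < \<epsilon>"
  shows "\<exists>\<beta>>0::real. \<beta> \<le> 1 \<and> (\<forall>R (A::'b set) B. finite A \<longrightarrow> finite B \<longrightarrow>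
           (\<exists>X Y. X \<subseteq> A \<and> Y \<subseteq> B \<and> \<beta> * card A \<le> card X \<and> \<beta> * card B \<le> card Y \<and> uniform_pair R \<epsilon> X Y))"
proof -
  define \<theta> where "\<theta> = min \<epsilon> 1"
  \<comment> \<open>The two completing rectangles cost \<open>2 * \<eta> * (x * y)\<close> in total,
    while \<open>u * v\<close> may be as small as \<open>\<theta> ^ 2 * (x * y)\<close>; so
    \<open>2 * \<eta> \<le> \<theta> ^ 3\<close> is what the argument asks for. Capping
    \<open>\<theta>\<close> at 1 gives \<open>\<eta> \<le> \<theta>\<close>.\<close>
  define \<eta> where "\<eta> = \<theta> ^ 3 / 4"
  have \<theta>: "0 < \<theta>" "\<theta> \<le> 1" "\<theta> \<le> \<epsilon>" using assms by (auto simp: \<theta>_def)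
  have \<theta>3: "\<theta> ^ 3 \<le> \<theta>"
    using \<theta> power_decreasing[of 1 3 \<theta>] by simp
  have \<eta>: "0 < \<eta>" "\<eta> \<le> 1" "\<eta> \<le> \<theta>" using \<theta> \<theta>3 by (auto simp: \<eta>_def)
  obtain K :: nat where K: "1 / \<eta> < K" using reals_Archimedean2 by blast
  have K': "1 < \<eta> * K" using K \<eta> by (simp add: field_simps)
  show ?thesis
  proof (intro exI[of _ "\<eta> ^ K"] conjI allI impI)
    show "0 < \<eta> ^ K" "\<eta> ^ K \<le> 1" using \<eta> by (auto simp: power_le_one)
    fix R and A B :: "'b set"
    assume fin: "finite A" "finite B"
    obtain X Y where XY: "X \<subseteq> A" "Y \<subseteq> B" "\<eta> ^ K * card A \<le> card X" "\<eta> ^ K * card B \<le> card Y"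
      and up: "\<And>U V. U \<subseteq> X \<Longrightarrow> V \<subseteq> Y \<Longrightarrow> \<eta> * card X \<le> card U \<Longrightarrow> \<eta> * card Y \<le> card V \<Longrightarrow>
              pair_density R U V \<le> pair_density R X Y + \<eta>"
      using upper_uniform_subpair[OF \<eta>(1) K' \<eta>(2), where R = R and A = A and B = B] by metis
    have finXY: "finite X" "finite Y" using XY fin finite_subset by auto
    define d where "d = pair_density R X Y"
    define x y where "x = real (card X)" and "y = real (card Y)"
    have xy: "0 \<le> x" "0 \<le> y" by (auto simp: x_def y_def)
    have d: "0 \<le> d" by (simp add: d_def pair_density_nonneg)
    \<comment> \<open>A count with an additive error covers small subpairs as well: if one side
      falls below its \<open>\<eta>\<close> fraction, there are at most
      \<open>\<eta> * (x * y)\<close> pairs altogether.\<close>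
    have upper: "pair_count R U V \<le> d * (card U * card V) + \<eta> * (x * y)"
      if UV: "U \<subseteq> X" "V \<subseteq> Y" for U V
    proof -
      define u v where "u = real (card U)" and "v = real (card V)"
      have uv: "0 \<le> u" "u \<le> x" "0 \<le> v" "v \<le> y"
        using UV finXY by (auto simp: u_def v_def x_def y_def card_mono)
      have le: "pair_count R U V \<le> u * v" using pair_count_le by (simp add: u_def v_def)
      have nn: "0 \<le> d * (u * v)" using d uv by simp
      have "pair_count R U V \<le> d * (u * v) + \<eta> * (x * y)"
      proof (cases "\<eta> * x \<le> u \<and> \<eta> * y \<le> v")
        case True
        then have "pair_density R U V \<le> d + \<eta>"
          using up[OF UV] by (simp add: d_def u_def v_def x_def y_def)
        then have "pair_count R U V \<le> (d + \<eta>) * (u * v)"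
          using uv by (simp add: pair_count_eq_density u_def v_def mult_right_mono)
        also have "\<dots> \<le> d * (u * v) + \<eta> * (x * y)"
          using uv \<eta> by (simp add: distrib_right mult_left_mono mult_mono)
        finally show ?thesis .
      next
        case False
        have "u * v \<le> \<eta> * (x * y)"
        proof (cases "\<eta> * x \<le> u")
          case True
          then have "v \<le> \<eta> * y" using False by simp
          then have "u * v \<le> x * (\<eta> * y)" using uv xy by (intro mult_mono) auto
          then show ?thesis by (simp add: algebra_simps)
        next
          case False
          then have "u * v \<le> (\<eta> * x) * y" using uv xy \<eta> by (intro mult_mono) auto
          then show ?thesis by (simp add: algebra_simps)
        qed
        then show ?thesis using le nn by linarith
      qed
      then show ?thesis by (simp add: u_def v_def)
    qed
    have "\<bar>pair_density R U V - d\<bar> \<le> \<epsilon>"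
      if UV: "U \<subseteq> X" "V \<subseteq> Y" "\<epsilon> * x \<le> card U" "\<epsilon> * y \<le> card V" for U V
    proof -
      define u v where "u = real (card U)" and "v = real (card V)"
      have uv: "0 \<le> u" "u \<le> x" "0 \<le> v" "v \<le> y"
        using UV finXY by (auto simp: u_def v_def x_def y_def card_mono)
      have large: "\<theta> * x \<le> u" "\<theta> * y \<le> v"
        using UV(3,4) \<theta> xy mult_right_mono[of \<theta> \<epsilon> x] mult_right_mono[of \<theta> \<epsilon> y]
        by (auto simp: u_def v_def)
      have "\<eta> * x \<le> u" "\<eta> * y \<le> v"
        using large \<eta> xy mult_right_mono[of \<eta> \<theta> x] mult_right_mono[of \<eta> \<theta> y] by auto
      then have 1: "pair_density R U V \<le> d + \<epsilon>"
        using up[OF UV(1,2)] \<eta> \<theta> by (simp add: d_def u_def v_def x_def y_def)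
      have "d - \<epsilon> \<le> pair_density R U V"
      \<comment> \<open>If \<open>U\<close> or \<open>V\<close> is empty, largeness forces
        \<open>X\<close> or \<open>Y\<close> to be empty, and then \<open>d\<close> is 0 by division
        by zero.\<close>
      proof (cases "u * v = 0")
        case True
        then have "x = 0 \<or> y = 0"
          using large \<theta> xy by (smt (verit) mult_eq_0_iff mult_pos_pos)
        then have "d = 0" by (auto simp: d_def pair_density_def x_def y_def)
        then show ?thesis using pair_density_nonneg[of R U V] assms by linarith
      next
        case False
        then have pos: "0 < u * v" using uv by (simp add: less_le)
        have cV: "real (card (Y - V)) = y - v" and cU: "real (card (X - U)) = x - u"
          using UV finXY
          by (auto simp: card_Diff_subset finite_subset x_def y_def u_def v_def card_mono of_nat_diff)
        \<comment> \<open>If \<open>U, V\<close> were too sparse, the rest of the pair would exceed the upper bound.\<close>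
        have "d * (x * y) = pair_count R X Y"
          by (simp add: pair_count_eq_density d_def x_def y_def)
        also have "\<dots> = pair_count R U V + pair_count R U (Y - V) + pair_count R (X - U) Y"
          using pair_count_diff_left[OF finXY(1) UV(1), of R Y]
            pair_count_diff_right[OF finXY(2) UV(2), of R U] by simp
        also have "\<dots> \<le> pair_count R U V + (d * (u * (y - v)) + \<eta> * (x * y)) + (d * ((x - u) * y) + \<eta> * (x * y))"
          using upper[of U "Y - V"] upper[of "X - U" Y] UV cU cV
          by (simp add: u_def y_def)
        finally have "d * (u * v) - 2 * \<eta> * (x * y) \<le> pair_count R U V"
          by (simp add: algebra_simps)
        moreover have "2 * \<eta> * (x * y) \<le> \<epsilon> * (u * v)"
        proof -
          have "2 * \<eta> * (x * y) \<le> \<theta> * ((\<theta> * x) * (\<theta> * y))"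
            using \<theta> xy by (simp add: \<eta>_def power3_eq_cube)
          also have "\<dots> \<le> \<epsilon> * (u * v)"
            using large \<theta> xy uv by (intro mult_mono) auto
          finally show ?thesis .
        qed
        ultimately have "(d - \<epsilon>) * (u * v) \<le> pair_density R U V * (u * v)"
          by (simp add: pair_count_eq_density u_def v_def algebra_simps)
        then show ?thesis using pos by (simp only: mult_le_cancel_right_pos)
      qed
      then show ?thesis using 1 by linarith
    qed
    then have "uniform_pair R \<epsilon> X Y"
      by (simp add: uniform_pair_def d_def x_def y_def)
    then show "\<exists>X Y. X \<subseteq> A \<and> Y \<subseteq> B \<and> \<eta> ^ K * card A \<le> card X \<and> \<eta> ^ K * card B \<le> card Y \<and>
        uniform_pair R \<epsilon> X Y" using XY by blast
  qed
qed

text \<open>An \<open>\<epsilon>\<close> fraction of \<open>X\<close> is at least an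
  \<open>\<epsilon> * \<beta>\<close> fraction of \<open>A\<close>, so the densities of
  \<open>(U, V)\<close> and of \<open>(X, Y)\<close> both lie within \<open>\<epsilon>'\<close> of
  that of \<open>(A, B)\<close>. The factor 1/2 pays for the triangle inequality.\<close>

lemma uniform_pair_subset:
  fixes \<epsilon> \<epsilon>' \<beta> :: real
  assumes "uniform_pair R \<epsilon>' A B" "X \<subseteq> A" "Y \<subseteq> B" "\<beta> * card A \<le> card X" "\<beta> * card B \<le> card Y"
    and "0 < \<epsilon>" "\<epsilon> \<le> 1" "0 < \<beta>" "\<beta> \<le> 1" "\<epsilon>' \<le> \<epsilon> * \<beta> / 2"
  shows "uniform_pair R \<epsilon> X Y"
proof -
  have \<epsilon>': "\<epsilon>' \<le> \<epsilon> * \<beta>" using assms(6,8,10) by (smt (verit) field_sum_of_halves mult_pos_pos)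
  have half: "\<epsilon>' \<le> \<epsilon> / 2" using assms(6-10) by (smt (verit) divide_right_mono mult_left_le)
  have "\<epsilon> * \<beta> \<le> \<beta>" using assms by (simp add: mult_left_le_one_le)
  then have \<epsilon>\<beta>: "\<epsilon>' \<le> \<beta>" using \<epsilon>' by linarith
  have D: "\<bar>pair_density R U V - pair_density R A B\<bar> \<le> \<epsilon>'"
    if "U \<subseteq> A" "V \<subseteq> B" "\<epsilon> * \<beta> * card A \<le> card U" "\<epsilon> * \<beta> * card B \<le> card V" for U V
  proof -
    have "\<epsilon>' * card A \<le> card U" "\<epsilon>' * card B \<le> card V"
      using that(3,4) mult_right_mono[OF \<epsilon>', of "card A"] mult_right_mono[OF \<epsilon>', of "card B"] by linarith+
    then show ?thesis using assms(1) that by (simp add: uniform_pair_def)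
  qed
  have "\<epsilon>' * card A \<le> card X" "\<epsilon>' * card B \<le> card Y"
    using assms(4,5) mult_right_mono[OF \<epsilon>\<beta>, of "card A"] mult_right_mono[OF \<epsilon>\<beta>, of "card B"] by linarith+
  then have DX: "\<bar>pair_density R X Y - pair_density R A B\<bar> \<le> \<epsilon>'"
    using assms(1-3) by (simp add: uniform_pair_def)
  show ?thesis unfolding uniform_pair_def
  proof (intro allI impI)
    fix U V assume UV: "U \<subseteq> X" "V \<subseteq> Y" "\<epsilon> * card X \<le> card U" "\<epsilon> * card Y \<le> card V"
    have "\<epsilon> * \<beta> * card A \<le> card U" "\<epsilon> * \<beta> * card B \<le> card V"
      using UV(3,4) mult_left_mono[OF assms(4) less_imp_le[OF assms(6)]]
        mult_left_mono[OF assms(5) less_imp_le[OF assms(6)]]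
      unfolding mult.assoc by linarith+
    then have "\<bar>pair_density R U V - pair_density R A B\<bar> \<le> \<epsilon>'"
      using D UV assms(2,3) by blast
    then show "\<bar>pair_density R U V - pair_density R X Y\<bar> \<le> \<epsilon>"
      using DX half by linarith
  qed
qed

text \<open>In the induction the new pair is refined first, with a tolerance that survives the later
  loss \<open>\<beta>1\<close>; only then does the induction hypothesis shrink all sets for the
  remaining triples. The third component names the relation. Since \<open>\<beta>\<close> precedes
  \<open>R\<close> and \<open>I\<close>, it can be fixed before \<open>n\<close> and the
  coloring.\<close>

lemma uniform_subfamily:
  fixes \<epsilon> :: real and S :: "('k \<times> 'k \<times> 'q) set"
  assumes "finite S" "0 < \<epsilon>" "\<epsilon> \<le> 1" "\<forall>(u, v, q) \<in> S. u \<noteq> v"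
  shows "\<exists>\<beta>>0::real. \<beta> \<le> 1 \<and> (\<forall>R (I :: 'k \<Rightarrow> 'b set). (\<forall>j. finite (I j)) \<longrightarrow>
           (\<exists>W. (\<forall>j. W j \<subseteq> I j \<and> \<beta> * card (I j) \<le> card (W j)) \<and>
                (\<forall>(u, v, q) \<in> S. uniform_pair (R q) \<epsilon> (W u) (W v))))"
  using assms(1,4)
proof (induction S)
  case empty
  show ?case by (intro exI[of _ "1::real"]) auto
next
  case (insert p S)
  obtain u v q where p: "p = (u, v, q)" by (cases p)
  have uv: "u \<noteq> v" using insert.prems p by auto
  obtain \<beta>1 :: real where \<beta>1: "0 < \<beta>1" "\<beta>1 \<le> 1" and fam: "\<And>R (I :: 'k \<Rightarrow> 'b set). (\<forall>j. finite (I j)) \<Longrightarrow>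
           (\<exists>W. (\<forall>j. W j \<subseteq> I j \<and> \<beta>1 * card (I j) \<le> card (W j)) \<and>
                (\<forall>(u, v, q) \<in> S. uniform_pair (R q) \<epsilon> (W u) (W v)))"
    using insert.IH insert.prems by auto
  \<comment> \<open>The tolerance demanded by \<open>uniform_pair_subset\<close> for subsets of
    proportion \<open>\<beta>1\<close>.\<close>
  have "0 < \<epsilon> * \<beta>1 / 2" using \<beta>1 assms by simp
  from uniform_subpair[OF this]
  obtain \<beta>2 :: real where \<beta>2: "0 < \<beta>2" "\<beta>2 \<le> 1" and
    pair: "\<And>R (A::'b set) B. finite A \<Longrightarrow> finite B \<Longrightarrow>
      \<exists>X Y. X \<subseteq> A \<and> Y \<subseteq> B \<and> \<beta>2 * card A \<le> card X \<and> \<beta>2 * card B \<le> card Y \<and>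
        uniform_pair R (\<epsilon> * \<beta>1 / 2) X Y"
    by metis
  show ?case
  proof (intro exI[of _ "\<beta>1 * \<beta>2"] conjI allI impI)
    show "0 < \<beta>1 * \<beta>2" "\<beta>1 * \<beta>2 \<le> 1" using \<beta>1 \<beta>2 by (auto simp: mult_le_one)
    fix R and I :: "'k \<Rightarrow> 'b set"
    assume fin: "\<forall>j. finite (I j)"
    obtain X Y where XY: "X \<subseteq> I u" "Y \<subseteq> I v" "\<beta>2 * card (I u) \<le> card X" "\<beta>2 * card (I v) \<le> card Y"
        "uniform_pair (R q) (\<epsilon> * \<beta>1 / 2) X Y"
      using pair[of "I u" "I v" "R q"] fin by auto
    \<comment> \<open>Because \<open>u \<noteq> v\<close>, the two updates do not overwrite each
      other.\<close>
    define I' where "I' = I(u := X, v := Y)"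
    have I': "I' j \<subseteq> I j" "\<beta>2 * card (I j) \<le> card (I' j)" for j
      using XY \<beta>2 by (auto simp: I'_def mult_left_le_one_le)
    have "\<forall>j. finite (I' j)" using I'(1) fin by (blast intro: finite_subset)
    from fam[OF this, of R] obtain W where "\<forall>j. W j \<subseteq> I' j \<and> \<beta>1 * card (I' j) \<le> card (W j)"
      and WS: "\<forall>(u, v, q) \<in> S. uniform_pair (R q) \<epsilon> (W u) (W v)" by (elim exE conjE)
    then have W: "W j \<subseteq> I' j" "\<beta>1 * card (I' j) \<le> card (W j)" for j by auto
    have I'uv: "I' u = X" "I' v = Y" using uv by (auto simp: I'_def)
    have "uniform_pair (R q) \<epsilon> (W u) (W v)"
      using uniform_pair_subset[OF XY(5), of "W u" "W v" \<beta>1 \<epsilon>] W(1,2)[of u] W(1,2)[of v] I'uv \<beta>1 assms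
      by auto
    moreover have "\<beta>1 * \<beta>2 * card (I j) \<le> card (W j)" for j
      using W(2)[of j] mult_left_mono[OF I'(2)[of j] less_imp_le[OF \<beta>1(1)]]
      unfolding mult.assoc by linarith
    ultimately show "\<exists>W. (\<forall>j. W j \<subseteq> I j \<and> \<beta>1 * \<beta>2 * card (I j) \<le> card (W j)) \<and>
            (\<forall>(u, v, q) \<in> insert p S. uniform_pair (R q) \<epsilon> (W u) (W v))"
      using WS W(1) I'(1) p by (intro exI[of _ W]) (blast intro: subset_trans)
  qed
qed

section \<open>Lower-dense pairs and degrees\<close>

text \<open>The one-sided consequence of uniformity on which the embedding rests. Multiplying out
  the density makes the condition trivial for empty subsets.\<close>

definition lower_dense :: "('b set \<Rightarrow> bool) \<Rightarrow> real \<Rightarrow> real \<Rightarrow> 'b set \<Rightarrow> 'b set \<Rightarrow> bool" where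
  "lower_dense R \<epsilon> d A B \<longleftrightarrow>
     (\<forall>X Y. X \<subseteq> A \<longrightarrow> Y \<subseteq> B \<longrightarrow> \<epsilon> * card A \<le> card X \<longrightarrow> \<epsilon> * card B \<le> card Y \<longrightarrow>
        d * (real (card X) * real (card Y)) \<le> pair_count R X Y)"

lemma uniform_imp_lower_dense:
  assumes "uniform_pair R \<epsilon> A B" "d + \<epsilon> \<le> pair_density R A B"
  shows "lower_dense R \<epsilon> d A B"
  unfolding lower_dense_def
proof (intro allI impI)
  fix X Y assume "X \<subseteq> A" "Y \<subseteq> B" "\<epsilon> * card A \<le> card X" "\<epsilon> * card B \<le> card Y"
  then have "\<bar>pair_density R X Y - pair_density R A B\<bar> \<le> \<epsilon>"
    using assms(1) by (simp add: uniform_pair_def)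
  then show "d * (real (card X) * real (card Y)) \<le> pair_count R X Y"
    using assms(2) unfolding pair_count_eq_density by (intro mult_right_mono) auto
qed

lemma lower_dense_commute: "lower_dense R \<epsilon> d A B \<Longrightarrow> lower_dense R \<epsilon> d B A"
  unfolding lower_dense_def by (metis pair_count_commute mult.commute)

lemma lower_dense_mono:
  fixes \<epsilon> \<epsilon>' :: real
  assumes "lower_dense R \<epsilon> d A B" "\<epsilon> \<le> \<epsilon>'" "d' \<le> d"
  shows "lower_dense R \<epsilon>' d' A B"
  unfolding lower_dense_def
proof (intro allI impI)
  fix X Y assume XY: "X \<subseteq> A" "Y \<subseteq> B" "\<epsilon>' * card A \<le> card X" "\<epsilon>' * card B \<le> card Y"
  have "\<epsilon> * card A \<le> card X" "\<epsilon> * card B \<le> card Y"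
    using XY(3,4) mult_right_mono[OF assms(2), of "card A"] mult_right_mono[OF assms(2), of "card B"]
    by auto
  then have "d * (real (card X) * real (card Y)) \<le> pair_count R X Y"
    using assms(1) XY by (simp add: lower_dense_def)
  then show "d' * (real (card X) * real (card Y)) \<le> pair_count R X Y"
    using mult_right_mono[OF assms(3), of "real (card X) * real (card Y)"] by simp
qed

text \<open>An \<open>\<epsilon>'\<close> fraction of \<open>X\<close> is at least an
  \<open>\<epsilon>' * \<beta>\<close> fraction of \<open>A\<close>. Only the size threshold
  deteriorates; the bound \<open>d\<close> is inherited in full, which allows repeated passage to
  link sets.\<close>

lemma lower_dense_subset:
  fixes \<epsilon> \<epsilon>' \<beta> :: real
  assumes "lower_dense R \<epsilon> d A B" "X \<subseteq> A" "Y \<subseteq> B" "\<beta> * card A \<le> card X" "\<beta> * card B \<le> card Y"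
    and "0 \<le> \<epsilon>'" "\<epsilon> \<le> \<epsilon>' * \<beta>"
  shows "lower_dense R \<epsilon>' d X Y"
  unfolding lower_dense_def
proof (intro allI impI)
  fix U V assume UV: "U \<subseteq> X" "V \<subseteq> Y" "\<epsilon>' * card X \<le> card U" "\<epsilon>' * card Y \<le> card V"
  have "\<epsilon> * card A \<le> card U" "\<epsilon> * card B \<le> card V"
    using UV(3,4) mult_left_mono[OF assms(4) assms(6)] mult_left_mono[OF assms(5) assms(6)]
      mult_right_mono[OF assms(7), of "card A"] mult_right_mono[OF assms(7), of "card B"]
    unfolding mult.assoc by linarith+
  then show "d * (real (card U) * real (card V)) \<le> pair_count R U V"
    using assms(1-3) UV by (simp add: lower_dense_def)
qed

text \<open>More low-degree vertices than that would form, together with the whole of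
  \<open>B\<close>, a large subpair containing too few pairs.\<close>

lemma card_low_degree_le:
  fixes \<epsilon> d :: real
  assumes "lower_dense R \<epsilon> d A B" "\<epsilon> \<le> 1" "0 \<le> \<epsilon>" "finite A" "finite B"
  shows "card {x \<in> A. card {y \<in> B. R {x, y}} < d * card B} \<le> \<epsilon> * card A"
proof (rule ccontr)
  define X where "X = {x \<in> A. card {y \<in> B. R {x, y}} < d * card B}"
  assume "\<not> ?thesis"
  then have X: "\<epsilon> * card A < card X" by (simp add: X_def)
  have XA: "X \<subseteq> A" by (auto simp: X_def)
  \<comment> \<open>The strict comparison of sums at the end requires \<open>X\<close> to be
    nonempty.\<close>
  have "0 \<le> \<epsilon> * card A" using assms(3) by simp
  then have "0 < real (card X)" using X by linarith
  then have ne: "X \<noteq> {}" "finite X" by (auto simp: card_gt_0_iff)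
  have "\<epsilon> * card B \<le> card B" using assms(2,3) by (simp add: mult_left_le_one_le)
  then have "d * (real (card X) * real (card B)) \<le> pair_count R X B"
    using assms(1) X XA by (simp add: lower_dense_def)
  also have "\<dots> = (\<Sum>x\<in>X. real (card {y \<in> B. R {x, y}}))"
    unfolding pair_count_def using assms(5)
    by (intro sum.cong) (simp_all add: of_bool_def sum.If_cases Int_def)
  also have "\<dots> < (\<Sum>x\<in>X. d * card B)"
    using ne by (intro sum_strict_mono) (auto simp: X_def)
  finally show False by (simp add: algebra_simps)
qed

section \<open>Counting partite homomorphisms\<close>

text \<open>Extensional maps, so that each assignment on \<open>V\<close> is counted once.
  Injectivity will come from the disjointness of the clusters.\<close>

definition partite_homs :: "('b set \<Rightarrow> bool) \<Rightarrow> 'v set set \<Rightarrow> 'v set \<Rightarrow> ('v \<Rightarrow> 'b set) \<Rightarrow> ('v \<Rightarrow> 'b) set" where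
  "partite_homs R E V W = {g \<in> Pi\<^sub>E V W. \<forall>e\<in>E. R (g ` e)}"

lemma finite_partite_homs: "finite V \<Longrightarrow> \<forall>v\<in>V. finite (W v) \<Longrightarrow> finite (partite_homs R E V W)"
  unfolding partite_homs_def by (rule finite_subset[of _ "Pi\<^sub>E V W"]) (auto intro: finite_PiE)

text \<open>The candidate sets of the remaining vertices after \<open>v\<close> has been mapped to \<open>x\<close>.\<close>

definition link_sets :: "('b set \<Rightarrow> bool) \<Rightarrow> 'v set set \<Rightarrow> ('v \<Rightarrow> 'b set) \<Rightarrow> 'v \<Rightarrow> 'b \<Rightarrow> 'v \<Rightarrow> 'b set" where
  "link_sets R E W v x w = (if {v, w} \<in> E then {y \<in> W w. R {x, y}} else W w)"

text \<open>Extending \<open>g\<close> by \<open>v \<mapsto> x\<close> injects the disjoint union of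
  the smaller families into the large one: membership in the link sets takes care of exactly the
  edges through \<open>v\<close>.\<close>

lemma sum_card_partite_homs_le:
  assumes "finite V" "v \<notin> V" "\<forall>w\<in>insert v V. finite (W w)"
    and "\<forall>e\<in>E. e \<subseteq> insert v V \<and> card e = 2" "X \<subseteq> W v"
  shows "(\<Sum>x\<in>X. card (partite_homs R {e \<in> E. v \<notin> e} V (link_sets R E W v x)))
           \<le> card (partite_homs R E (insert v V) W)"
proof -
  let ?P = "\<lambda>x. partite_homs R {e \<in> E. v \<notin> e} V (link_sets R E W v x)"
  have fin: "finite X" using assms finite_subset by blast
  have finP: "finite (?P x)" for x
    using assms by (intro finite_partite_homs) (auto simp: link_sets_def)
  have "(\<Sum>x\<in>X. card (?P x)) = card (Sigma X ?P)"
    using fin finP by simp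
  also have "\<dots> \<le> card (partite_homs R E (insert v V) W)"
  proof (rule card_inj_on_le)
    show "inj_on (\<lambda>(x, g). g(v := x)) (Sigma X ?P)"
    proof (rule inj_onI, clarify)
      fix x g x' g'
      assume g: "g \<in> ?P x" and g': "g' \<in> ?P x'" and eq: "g(v := x) = g'(v := x')"
      \<comment> \<open>Both maps have the default value at \<open>v\<close>, so overwriting it
        loses no information.\<close>
      have "g v = undefined" "g' v = undefined"
        using g g' assms(2) by (auto simp: partite_homs_def PiE_def extensional_def)
      moreover have "x = x'" using eq by (metis fun_upd_same)
      ultimately show "x = x' \<and> g = g'" using eq by (metis fun_upd_triv fun_upd_upd)
    qed
    show "finite (partite_homs R E (insert v V) W)"
      using assms by (intro finite_partite_homs) auto
    show "(\<lambda>(x, g). g(v := x)) ` Sigma X ?P \<subseteq> partite_homs R E (insert v V) W"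
    proof clarify
      fix x g assume x: "x \<in> X" and g: "g \<in> ?P x"
      have gl: "g \<in> Pi\<^sub>E V (link_sets R E W v x)" and gE: "\<forall>e\<in>E. v \<notin> e \<longrightarrow> R (g ` e)"
        using g by (auto simp: partite_homs_def)
      have "g \<in> Pi\<^sub>E V W"
        using gl by (rule subsetD[OF PiE_mono, rotated]) (auto simp: link_sets_def)
      then have "g(v := x) \<in> Pi\<^sub>E (insert v V) W"
        using x assms(5) by (intro PiE_fun_upd) auto
      moreover have "R ((g(v := x)) ` e)" if e: "e \<in> E" for e
      proof (cases "v \<in> e")
        case False
        then have "(g(v := x)) ` e = g ` e" by (intro image_cong) auto
        then show ?thesis using gE e False by simp
      next
        case True
        obtain a b where "e = {a, b}" "a \<noteq> b" using assms(4) e by (meson card_2_iff)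
        with True obtain w where w: "e = {v, w}" "w \<noteq> v" by fastforce
        then have "w \<in> V" using assms(4) e by auto
        then have "g w \<in> link_sets R E W v x w" using gl by auto
        then have "R {x, g w}" using w e by (simp add: link_sets_def)
        then show ?thesis using w by (simp add: insert_commute)
      qed
      ultimately show "g(v := x) \<in> partite_homs R E (insert v V) W"
        by (simp add: partite_homs_def)
    qed
  qed
  finally show ?thesis .
qed

lemma delta_pos: "0 < d \<Longrightarrow> 0 < delta h d"
  by (induction h d rule: delta.induct) auto

text \<open>
  The pairs are only assumed to have density \<open>d / 2\<close>: the other half of \<open>d\<close> absorbs the
  regularity error, and the bound \<open>d / 2\<close> for links is twice what the induction hypothesis requires.
\<close>

lemma card_partite_homs_ge:
  assumes "0 < d" "d \<le> 1"
  shows "\<exists>\<epsilon>>0::real. \<forall>(V :: 'v set) (W :: 'v \<Rightarrow> 'b set) E R. finite V \<longrightarrow> card V = h \<longrightarrow> (\<forall>v\<in>V. finite (W v)) \<longrightarrow>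
     (\<forall>e\<in>E. e \<subseteq> V \<and> card e = 2) \<longrightarrow>
     (\<forall>u v. u \<noteq> v \<longrightarrow> {u, v} \<in> E \<longrightarrow> lower_dense R \<epsilon> (d / 2) (W u) (W v)) \<longrightarrow>
     delta h d * (\<Prod>v\<in>V. real (card (W v))) \<le> card (partite_homs R E V W)"
  using assms
proof (induction h d rule: delta.induct)
  case (1 d)
  show ?case
  proof (intro exI[of _ 1] conjI allI impI)
    fix V :: "'v set" and W :: "'v \<Rightarrow> 'b set" and E R
    assume V: "finite V" "card V = 0" and E: "\<forall>e\<in>E. e \<subseteq> V \<and> card e = 2"
    have "E = {}" using E V by fastforce
    then show "delta 0 d * (\<Prod>v\<in>V. real (card (W v))) \<le> card (partite_homs R E V W)"
      using V by (simp add: partite_homs_def)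
  qed simp
next
  case (2 d)
  show ?case
  proof (intro exI[of _ 1] conjI allI impI)
    fix V :: "'v set" and W :: "'v \<Rightarrow> 'b set" and E R
    assume V: "finite V" "card V = Suc 0" and E: "\<forall>e\<in>E. e \<subseteq> V \<and> card e = 2"
    have "E = {}"
    proof (rule ccontr)
      assume "E \<noteq> {}"
      then obtain e where "e \<subseteq> V" "card e = 2" using E by auto
      then show False using card_mono[OF V(1), of e] V(2) by simp
    qed
    then show "delta (Suc 0) d * (\<Prod>v\<in>V. real (card (W v))) \<le> card (partite_homs R E V W)"
      using V by (simp add: partite_homs_def card_PiE)
  qed simp
next
  case (3 h d)
  obtain \<epsilon>1 :: real where \<epsilon>1: "0 < \<epsilon>1" and IH:
    "\<And>(V :: 'v set) (W :: 'v \<Rightarrow> 'b set) E R. finite V \<Longrightarrow> card V = Suc h \<Longrightarrow> (\<forall>v\<in>V. finite (W v)) \<Longrightarrow>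
     (\<forall>e\<in>E. e \<subseteq> V \<and> card e = 2) \<Longrightarrow>
     (\<forall>u v. u \<noteq> v \<longrightarrow> {u, v} \<in> E \<longrightarrow> lower_dense R \<epsilon>1 (d / 2 / 2) (W u) (W v)) \<Longrightarrow>
     delta (Suc h) (d / 2) * (\<Prod>v\<in>V. real (card (W v))) \<le> card (partite_homs R E V W)"
    using "3.IH" "3.prems" by (auto simp del: delta.simps)
  \<comment> \<open>The first entry lets \<open>lower_dense_subset\<close> supply the threshold
    \<open>\<epsilon>1\<close> on link sets of proportion \<open>d / 2\<close>; the second keeps the
    exceptional sets of up to \<open>Suc h\<close> neighbors within half of
    \<open>W v\<close>.\<close>
  define \<epsilon> where "\<epsilon> = min (\<epsilon>1 * (d / 2)) (1 / (2 * Suc h))"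
  have \<epsilon>: "0 < \<epsilon>" "\<epsilon> \<le> \<epsilon>1 * (d / 2)" "\<epsilon> \<le> 1 / (2 * Suc h)"
    using \<epsilon>1 "3.prems" by (auto simp: \<epsilon>_def)
  have \<epsilon>half: "Suc h * \<epsilon> \<le> 1 / 2" using \<epsilon>(3) by (simp add: field_simps)
  have "1 / (2 * real (Suc h)) \<le> 1" by (simp add: field_simps)
  then have \<epsilon>le1: "\<epsilon> \<le> 1" using \<epsilon>(3) by linarith
  show ?case
  proof (intro exI[of _ \<epsilon>] conjI allI impI)
    show "0 < \<epsilon>" by fact
    fix V' :: "'v set" and W :: "'v \<Rightarrow> 'b set" and E R
    assume V': "finite V'" "card V' = Suc (Suc h)" and finW: "\<forall>v\<in>V'. finite (W v)"
      and E: "\<forall>e\<in>E. e \<subseteq> V' \<and> card e = 2"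
      and ld: "\<forall>u v. u \<noteq> v \<longrightarrow> {u, v} \<in> E \<longrightarrow> lower_dense R \<epsilon> (d / 2) (W u) (W v)"
    obtain v V where vV: "V' = insert v V" "v \<notin> V" "card V = Suc h" "finite V"
      using V' by (metis card_Suc_eq card_eq_SucD finite_insert)
    define low where "low w = {x \<in> W v. card {y \<in> W w. R {x, y}} < d / 2 * card (W w)}" for w
    define N where "N = {w \<in> V. {v, w} \<in> E}"
    \<comment> \<open>The images of \<open>v\<close> that have large degree into all neighboring
      clusters at once; a union bound shows that they fill at least half of
      \<open>W v\<close>.\<close>
    define X where "X = W v - (\<Union>w\<in>N. low w)"
    have finN: "finite N" "card N \<le> Suc h"
      using vV card_mono[of V N] by (auto simp: N_def)
    have low: "card (low w) \<le> \<epsilon> * card (W v)" if "w \<in> N" for w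
      unfolding low_def
    proof (rule card_low_degree_le)
      have "v \<noteq> w" using that vV by (auto simp: N_def)
      then show "lower_dense R \<epsilon> (d / 2) (W v) (W w)" using that ld by (simp add: N_def)
    qed (use that finW vV \<epsilon>(1) \<epsilon>le1 in \<open>auto simp: N_def\<close>)
    have "real (card (\<Union>w\<in>N. low w)) \<le> (\<Sum>w\<in>N. real (card (low w)))"
      using card_UN_le[OF finN(1), of low] by (simp flip: of_nat_sum)
    also have "\<dots> \<le> card N * (\<epsilon> * card (W v))"
      using sum_mono[of N "\<lambda>w. real (card (low w))" "\<lambda>_. \<epsilon> * card (W v)"] low by simp
    also have "\<dots> \<le> Suc h * (\<epsilon> * card (W v))"
      using finN \<epsilon> by (intro mult_right_mono) auto
    also have "\<dots> \<le> 1 / 2 * card (W v)"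
      using mult_right_mono[OF \<epsilon>half, of "card (W v)"] by (simp add: mult.assoc)
    finally have bad: "real (card (\<Union>w\<in>N. low w)) \<le> 1 / 2 * card (W v)" .
    have sub: "(\<Union>w\<in>N. low w) \<subseteq> W v" by (auto simp: low_def)
    have finv: "finite (W v)" using finW vV by auto
    have "real (card X) = card (W v) - real (card (\<Union>w\<in>N. low w))"
      unfolding X_def using sub finv by (simp add: card_Diff_subset finite_subset card_mono of_nat_diff)
    then have cX: "1 / 2 * card (W v) \<le> card X" using bad by linarith
    have XW: "X \<subseteq> W v" by (auto simp: X_def)
    let ?L = "link_sets R E W v"
    have L: "?L x w \<subseteq> W w" "d / 2 * card (W w) \<le> card (?L x w)" if "x \<in> X" "w \<in> V" for x w
    proof -
      show "?L x w \<subseteq> W w" by (auto simp: link_sets_def)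
      \<comment> \<open>This serves the non-neighbors of \<open>v\<close>, whose candidate sets
        remain whole.\<close>
      have "d / 2 * card (W w) \<le> card (W w)"
        using "3.prems" by (intro mult_left_le_one_le) auto
      then show "d / 2 * card (W w) \<le> card (?L x w)"
        using that by (auto simp: link_sets_def X_def low_def N_def not_less)
    qed
    \<comment> \<open>A lower bound for the extensions of each single \<open>x \<in> X\<close>: each
      of the \<open>Suc h\<close> link sets keeps a \<open>d / 2\<close> fraction of its cluster.
      Together with the bound on \<open>X\<close> it reproduces the recursion of
      \<open>delta\<close>.\<close>
    define m where "m = delta (Suc h) (d / 2) * (d / 2) ^ Suc h * (\<Prod>w\<in>V. real (card (W w)))"
    have \<delta>0: "0 \<le> delta (Suc h) (d / 2)" using "3.prems" by (simp add: delta_pos less_imp_le)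
    have m0: "0 \<le> m" using \<delta>0 "3.prems" by (auto simp: m_def intro!: mult_nonneg_nonneg prod_nonneg)
    have m: "m \<le> card (partite_homs R {e \<in> E. v \<notin> e} V (?L x))" if x: "x \<in> X" for x
    proof -
      have "m = delta (Suc h) (d / 2) * (\<Prod>w\<in>V. d / 2 * real (card (W w)))"
        using vV(3) by (simp only: m_def prod.distrib prod_constant mult.assoc)
      also have "\<dots> \<le> delta (Suc h) (d / 2) * (\<Prod>w\<in>V. real (card (?L x w)))"
        using L(2)[OF x] "3.prems" \<delta>0 by (intro mult_left_mono prod_mono) auto
      also have "\<dots> \<le> card (partite_homs R {e \<in> E. v \<notin> e} V (?L x))"
      proof (rule IH)
        show "\<forall>w\<in>V. finite (?L x w)" using L(1)[OF x] finW vV finite_subset by blast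
        show "\<forall>e\<in>{e \<in> E. v \<notin> e}. e \<subseteq> V \<and> card e = 2" using E vV by auto
        show "\<forall>u w. u \<noteq> w \<longrightarrow> {u, w} \<in> {e \<in> E. v \<notin> e} \<longrightarrow> lower_dense R \<epsilon>1 (d / 2 / 2) (?L x u) (?L x w)"
        proof (intro allI impI)
          fix u w assume uw: "u \<noteq> w" "{u, w} \<in> {e \<in> E. v \<notin> e}"
          then have uV: "u \<in> V" "w \<in> V" using E vV by auto
          have "lower_dense R \<epsilon> (d / 2) (W u) (W w)" using ld uw by auto
          from lower_dense_subset[OF this L(1)[OF x uV(1)] L(1)[OF x uV(2)] L(2)[OF x uV(1)] L(2)[OF x uV(2)]]
          have "lower_dense R \<epsilon>1 (d / 2) (?L x u) (?L x w)" using \<epsilon>1 \<epsilon> by simp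
          then show "lower_dense R \<epsilon>1 (d / 2 / 2) (?L x u) (?L x w)"
            using "3.prems" by (elim lower_dense_mono) auto
        qed
      qed (use vV in auto)
      finally show ?thesis .
    qed
    have "delta (Suc (Suc h)) d * (\<Prod>v\<in>V'. real (card (W v))) = 1 / 2 * card (W v) * m"
      using vV by (simp add: m_def del: power_Suc)
    also have "\<dots> \<le> card X * m" using cX m0 by (intro mult_right_mono)
    also have "\<dots> \<le> (\<Sum>x\<in>X. real (card (partite_homs R {e \<in> E. v \<notin> e} V (?L x))))"
      using sum_mono[of X "\<lambda>_. m" "\<lambda>x. real (card (partite_homs R {e \<in> E. v \<notin> e} V (?L x)))"] m by simp
    also have "\<dots> \<le> card (partite_homs R E V' W)"
      using sum_card_partite_homs_le[of V v W E X R] vV finW E XW by (simp flip: of_nat_sum)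
    finally show "delta (Suc (Suc h)) d * (\<Prod>v\<in>V'. real (card (W v))) \<le> card (partite_homs R E V' W)" .
  qed
qed

section \<open>Colorings, densities and ordered copies\<close>

text \<open>This links embeddings to the position-wise condition in \<open>arises_from\<close>, and
  it shows that an increasing map is determined by its image.\<close>

lemma sorted_list_of_set_strict_mono_image:
  assumes "finite V" "strict_mono_on V f"
  shows "sorted_list_of_set (f ` V) = map f (sorted_list_of_set V)"
proof -
  have "sorted_wrt (<) (map f (sorted_list_of_set V))"
    unfolding sorted_wrt_map
  proof (rule sorted_wrt_mono_rel[OF _ strict_sorted_list_of_set])
    fix x y assume "x \<in> set (sorted_list_of_set V)" "y \<in> set (sorted_list_of_set V)" "x < y"
    then show "f x < f y" using assms by (auto dest: strict_mono_onD)
  qed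
  moreover have "sorted_wrt (<) (sorted_list_of_set (f ` V))" by (rule strict_sorted_list_of_set)
  ultimately show ?thesis using assms(1) by (intro strict_sorted_equal) auto
qed

text \<open>For disjoint sides a doubleton \<open>{a, b}\<close> determines which end lies in
  \<open>A\<close>, so edges correspond to ordered pairs.\<close>

lemma edge_count_eq_pair_count:
  assumes "finite A" "finite B" "A \<inter> B = {}"
  shows "real (edge_count \<chi> \<gamma> A B) = pair_count (\<lambda>e. \<chi> e = \<gamma>) A B"
proof -
  let ?P = "SIGMA a:A. {b \<in> B. \<chi> {a, b} = \<gamma>}"
  have "{{a, b} |a b. a \<in> A \<and> b \<in> B \<and> \<chi> {a, b} = \<gamma>} = (\<lambda>(a, b). {a, b}) ` ?P"
    by auto
  moreover have "inj_on (\<lambda>(a, b). {a, b}) ?P"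
    using assms(3) by (auto simp: inj_on_def doubleton_eq_iff)
  ultimately have "edge_count \<chi> \<gamma> A B = card ?P"
    by (simp add: edge_count_def card_image)
  also have "\<dots> = (\<Sum>a\<in>A. card {b \<in> B. \<chi> {a, b} = \<gamma>})"
    using assms by simp
  finally show ?thesis
    using assms(2) unfolding pair_count_def
    by (simp add: of_bool_def sum.If_cases Int_def)
qed

lemma edge_density_eq_pair_density:
  assumes "finite A" "finite B" "A \<inter> B = {}"
  shows "edge_density \<chi> \<gamma> A B = pair_density (\<lambda>e. \<chi> e = \<gamma>) A B"
  using assms by (simp add: edge_density_def pair_density_def edge_count_eq_pair_count)

lemma regular_pairI:
  assumes "finite A" "finite B" "A \<inter> B = {}"
    and "\<And>\<gamma>. \<gamma> \<in> {1..c} \<Longrightarrow> uniform_pair (\<lambda>e. \<chi> e = \<gamma>) \<epsilon> A B"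
  shows "regular_pair \<chi> c \<epsilon> A B"
  unfolding regular_pair_def
proof (intro allI impI ballI, elim conjE)
  fix X Y \<gamma>
  assume XY: "X \<subseteq> A" "Y \<subseteq> B" "\<epsilon> * card A \<le> card X" "\<epsilon> * card B \<le> card Y" and \<gamma>: "\<gamma> \<in> {1..c}"
  have "finite X" "finite Y" "X \<inter> Y = {}" using XY assms finite_subset by auto
  then show "\<bar>edge_density \<chi> \<gamma> X Y - edge_density \<chi> \<gamma> A B\<bar> \<le> \<epsilon>"
    using assms(4)[OF \<gamma>] XY assms(1-3)
    by (simp add: edge_density_eq_pair_density uniform_pair_def)
qed

text \<open>Each pair has exactly one color in \<open>K\<close>; after exchanging the sums, the
  inner sum over colors is 1.\<close>

lemma sum_pair_density:
  assumes "finite A" "finite B" "A \<noteq> {}" "B \<noteq> {}" "finite K"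
    and "\<And>a b. a \<in> A \<Longrightarrow> b \<in> B \<Longrightarrow> \<chi> {a, b} \<in> K"
  shows "(\<Sum>\<gamma>\<in>K. pair_density (\<lambda>e. \<chi> e = \<gamma>) A B) = 1"
proof -
  have "(\<Sum>\<gamma>\<in>K. pair_count (\<lambda>e. \<chi> e = \<gamma>) A B) = (\<Sum>a\<in>A. \<Sum>\<gamma>\<in>K. \<Sum>b\<in>B. of_bool (\<chi> {a, b} = \<gamma>))"
    unfolding pair_count_def by (rule sum.swap)
  also have "\<dots> = (\<Sum>a\<in>A. \<Sum>b\<in>B. \<Sum>\<gamma>\<in>K. of_bool (\<chi> {a, b} = \<gamma>))"
    by (intro sum.cong refl sum.swap)
  also have "\<dots> = (\<Sum>a\<in>A. \<Sum>b\<in>B. 1)"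
  proof (intro sum.cong refl)
    fix a b assume "a \<in> A" "b \<in> B"
    then have "\<chi> {a, b} \<in> K" by (rule assms(6))
    then show "(\<Sum>\<gamma>\<in>K. of_bool (\<chi> {a, b} = \<gamma>)) = (1::real)"
      using assms(5) by (simp add: of_bool_def)
  qed
  also have "\<dots> = real (card A) * real (card B)" by simp
  finally show ?thesis
    using assms by (simp add: pair_density_def flip: sum_divide_distrib)
qed

lemma finite_mono_copies: "finite (mono_copies \<chi> n i G)"
  by (rule finite_subset[of _ "Pow {1..n}"])
    (auto simp: mono_copies_def order_embedding_def complete_ograph_def)

lemma mono_copies_subset: "F \<in> mono_copies \<chi> n i G \<Longrightarrow> F \<subseteq> {1..n}"
  by (auto simp: mono_copies_def order_embedding_def complete_ograph_def)

lemma card_mono_copies_elem: "F \<in> mono_copies \<chi> n i G \<Longrightarrow> card F = num_verts G"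
  by (auto simp: mono_copies_def order_embedding_def num_verts_def card_image)

lemma mono_copies_eq_empty:
  assumes "n < num_verts G"
  shows "mono_copies \<chi> n i G = {}"
proof (rule equals0I)
  fix F assume F: "F \<in> mono_copies \<chi> n i G"
  have "card F \<le> n" using card_mono[OF _ mono_copies_subset[OF F]] by simp
  then show False using card_mono_copies_elem[OF F] assms by simp
qed

lemma finite_colorings: "finite (colorings n c)"
  unfolding colorings_def complete_ograph_def
  by (intro finite_PiE) (auto intro: finite_subset[of _ "Pow {1..n}"])

lemma ordered_multiplicity_le:
  "\<chi> \<in> colorings n c \<Longrightarrow>
    ordered_multiplicity lam n c G \<le> (\<Sum>i\<in>{1..c}. lam i * real (card (mono_copies \<chi> n i (G i))))"
  unfolding ordered_multiplicity_def by (intro Min_le finite_imageI finite_colorings) auto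

text \<open>Sending \<open>(F, g)\<close> to the image of \<open>g\<close> is injective: the
  clusters met by the image give back \<open>F\<close>, and \<open>g\<close> is the only increasing
  map with that image. The order of the clusters makes \<open>g\<close> increasing.\<close>

lemma sum_partite_homs_le_regular_copies:
  fixes W :: "nat \<Rightarrow> nat set" and G :: "'a::linorder ordered_graph"
  assumes G: "ordered_graph G"
    and Wn: "\<And>j. j \<in> {1..t} \<Longrightarrow> W j \<subseteq> {1..n}"
    and Wless: "\<And>u v x y. 1 \<le> u \<Longrightarrow> u < v \<Longrightarrow> v \<le> t \<Longrightarrow> x \<in> W u \<Longrightarrow> y \<in> W v \<Longrightarrow> x < y"
    and f: "\<And>F. F \<in> mono_copies \<rho> t i G \<Longrightarrow> order_embedding (f F) G (complete_ograph t) \<and> f F ` verts G = F"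
  shows "(\<Sum>F\<in>mono_copies \<rho> t i G.
            card (partite_homs (\<lambda>e. \<chi> e = i) (edges G) (verts G) (\<lambda>v. W (f F v))))
          \<le> card (regular_copies \<chi> n W t \<rho> i G)"
proof -
  let ?M = "mono_copies \<rho> t i G" and ?V = "verts G"
  let ?P = "\<lambda>F. partite_homs (\<lambda>e. \<chi> e = i) (edges G) ?V (\<lambda>v. W (f F v))"
  have finV: "finite ?V" using G by (simp add: ordered_graph_def)
  \<comment> \<open>A common element \<open>x\<close> of two clusters would satisfy
    \<open>x < x\<close>.\<close>
  have disj: "u = v" if "u \<in> {1..t}" "v \<in> {1..t}" "x \<in> W u" "x \<in> W v" for u v x
    using that Wless[of u v x x] Wless[of v u x x] by (cases u v rule: linorder_cases) auto
  have fF: "f F v \<in> {1..t}" "strict_mono_on ?V (f F)" "f F ` ?V = F" if "F \<in> ?M" "v \<in> ?V" for F v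
    using f[OF that(1)] that(2) by (auto simp: order_embedding_def complete_ograph_def)
  have gW: "g v \<in> W (f F v)" if "g \<in> ?P F" "v \<in> ?V" for F g v
    using that by (auto simp: partite_homs_def)
  have mono: "strict_mono_on ?V g" if F: "F \<in> ?M" and g: "g \<in> ?P F" for F g
  proof (rule strict_mono_onI)
    fix v w assume vw: "v \<in> ?V" "w \<in> ?V" "v < w"
    have "f F v < f F w" using fF(2)[OF F vw(1)] vw by (rule strict_mono_onD)
    then show "g v < g w"
      using Wless[of "f F v" "f F w"] fF(1)[OF F] gW[OF g] vw by simp
  qed
  have meets: "{j \<in> {1..t}. g ` ?V \<inter> W j \<noteq> {}} = F" if F: "F \<in> ?M" and g: "g \<in> ?P F" for F g
  proof -
    have "j \<in> F" if j: "j \<in> {1..t}" "g ` ?V \<inter> W j \<noteq> {}" for j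
    proof -
      obtain v where v: "v \<in> ?V" "g v \<in> W j" using j by auto
      then have "f F v = j" using disj[OF fF(1)[OF F v(1)] j(1)] gW[OF g] by blast
      then show ?thesis using v f[OF F] by auto
    qed
    moreover have "j \<in> {1..t} \<and> g ` ?V \<inter> W j \<noteq> {}" if "j \<in> F" for j
    proof -
      have "j \<in> f F ` ?V" using that f[OF F] by simp
      then obtain v where "v \<in> ?V" "j = f F v" by auto
      then show ?thesis using fF(1)[OF F] gW[OF g] by auto
    qed
    ultimately show ?thesis by blast
  qed
  have finP: "finite (?P F)" if F: "F \<in> ?M" for F
    using finV fF(1)[OF F] Wn by (intro finite_partite_homs) (auto intro: finite_subset)
  have finR: "finite (regular_copies \<chi> n W t \<rho> i G)"
    unfolding regular_copies_def using finite_mono_copies by (rule finite_subset[rotated]) auto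
  have "(\<Sum>F\<in>?M. card (?P F)) = card (Sigma ?M ?P)"
    using finP by (simp add: finite_mono_copies)
  also have "\<dots> \<le> card (regular_copies \<chi> n W t \<rho> i G)"
  proof (rule card_inj_on_le[OF _ _ finR])
    show "inj_on (\<lambda>(F, g). g ` ?V) (Sigma ?M ?P)"
    proof (rule inj_onI, clarify)
      fix F g F' g'
      assume F: "F \<in> ?M" "g \<in> ?P F" and F': "F' \<in> ?M" "g' \<in> ?P F'" and eq: "g ` ?V = g' ` ?V"
      \<comment> \<open>Both sides list the common image in increasing order, so \<open>g\<close>
        and \<open>g'\<close> agree on \<open>?V\<close>; extensionality settles the rest.\<close>
      have "map g (sorted_list_of_set ?V) = map g' (sorted_list_of_set ?V)"
        using sorted_list_of_set_strict_mono_image[OF finV mono[OF F]]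
          sorted_list_of_set_strict_mono_image[OF finV mono[OF F']] eq by simp
      then have "\<forall>v\<in>?V. g v = g' v" using finV by simp
      moreover have "g \<in> extensional ?V" "g' \<in> extensional ?V"
        using F F' by (auto simp: partite_homs_def PiE_def)
      ultimately have "g = g'" by (auto intro: extensionalityI)
      moreover have "F = F'" using meets[OF F] meets[OF F'] eq by simp
      ultimately show "F = F' \<and> g = g'" by simp
    qed
    show "(\<lambda>(F, g). g ` ?V) ` Sigma ?M ?P \<subseteq> regular_copies \<chi> n W t \<rho> i G"
    proof clarify
      fix F g assume F: "F \<in> ?M" and g: "g \<in> ?P F"
      let ?sl = "sorted_list_of_set ?V"
      have smono: "strict_mono_on ?V g" by (rule mono[OF F g])
      then have inj: "inj_on g ?V" by (rule strict_mono_on_imp_inj_on)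
      have gn: "g v \<in> {1..n}" if "v \<in> ?V" for v
        using gW[OF g that] Wn[OF fF(1)[OF F that]] by blast
      have edge: "g ` e \<in> edges (complete_ograph n)" if "e \<in> edges G" for e
      proof -
        have e: "e \<subseteq> ?V" "card e = 2" using G that by (auto simp: ordered_graph_def)
        then have "card (g ` e) = 2" using inj by (simp add: card_image inj_on_subset)
        then show ?thesis using e gn by (auto simp: complete_ograph_def)
      qed
      have "order_embedding g G (complete_ograph n)"
        using gn inj smono edge by (auto simp: order_embedding_def complete_ograph_def)
      moreover have "\<forall>e\<in>edges G. \<chi> (g ` e) = i" using g by (simp add: partite_homs_def)
      ultimately have "g ` ?V \<in> mono_copies \<chi> n i G" by (auto simp: mono_copies_def)
      moreover have "arises_from W (g ` ?V) F"
      proof -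
        have cards: "card (g ` ?V) = card ?V" "card F = card ?V"
          using inj card_mono_copies_elem[OF F] by (auto simp: card_image num_verts_def)
        have "sorted_list_of_set (g ` ?V) ! l \<in> W (sorted_list_of_set F ! l)" if l: "l < card F" for l
        proof -
          have l': "l < length ?sl" using l cards by simp
          then have v: "?sl ! l \<in> ?V" using nth_mem[OF l'] finV by simp
          have "sorted_list_of_set F = map (f F) ?sl"
            using sorted_list_of_set_strict_mono_image[OF finV fF(2)[OF F v]] fF(3)[OF F v] by simp
          then show ?thesis
            using sorted_list_of_set_strict_mono_image[OF finV smono] gW[OF g v] l' by simp
        qed
        then show ?thesis using cards by (simp add: arises_from_def)
      qed
      moreover have "card (g ` ?V \<inter> W j) \<le> 1" if j: "j \<in> {1..t}" for j
      proof -
        have "g v = g w" if vw: "v \<in> ?V" "w \<in> ?V" "g v \<in> W j" "g w \<in> W j" for v w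
        proof -
          have "f F v = j" "f F w = j"
            using disj[OF fF(1)[OF F] j] gW[OF g] vw by blast+
          moreover have "inj_on (f F) ?V"
            using fF(2)[OF F vw(1)] by (rule strict_mono_on_imp_inj_on)
          ultimately show ?thesis using vw by (auto dest: inj_onD)
        qed
        then show ?thesis using finV by (auto simp: card_le_Suc0_iff_eq)
      qed
      ultimately show "g ` ?V \<in> regular_copies \<chi> n W t \<rho> i G"
        using F by (auto simp: regular_copies_def)
    qed
  qed
  finally show ?thesis .
qed

text \<open>The densities of the \<open>c\<close> colors sum to 1, so the largest is at least their
  average.\<close>

lemma majority_pair_density:
  assumes "finite (W u)" "finite (W v)" "W u \<noteq> {}" "W v \<noteq> {}" "W u \<inter> W v = {}"
    and uv: "1 \<le> u" "u < v" "v \<le> t"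
    and sub: "W u \<subseteq> {1..n}" "W v \<subseteq> {1..n}"
    and \<chi>: "\<chi> \<in> colorings n c" and \<rho>: "reduced_coloring \<chi> c t W \<rho>"
  shows "1 / real c \<le> pair_density (\<lambda>e. \<chi> e = \<rho> {u, v}) (W u) (W v)"
proof -
  let ?d = "\<lambda>\<gamma>. pair_density (\<lambda>e. \<chi> e = \<gamma>) (W u) (W v)"
  have "\<chi> {a, b} \<in> {1..c}" if "a \<in> W u" "b \<in> W v" for a b
  proof -
    have "a \<noteq> b" using that assms(5) by auto
    then have "{a, b} \<in> edges (complete_ograph n)"
      using that sub by (auto simp: complete_ograph_def)
    then show ?thesis using \<chi> unfolding colorings_def by (rule PiE_mem[rotated])
  qed
  then have "1 = (\<Sum>\<gamma>\<in>{1..c}. ?d \<gamma>)"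
    using sum_pair_density[OF assms(1-4), of "{1..c}" \<chi>] by simp
  also have "\<dots> \<le> (\<Sum>\<gamma>\<in>{1..c}. ?d (\<rho> {u, v}))"
  proof (rule sum_mono)
    fix \<gamma> assume "\<gamma> \<in> {1..c}"
    then have "edge_density \<chi> \<gamma> (W u) (W v) \<le> edge_density \<chi> (\<rho> {u, v}) (W u) (W v)"
      using \<rho> uv unfolding reduced_coloring_def by blast
    then show "?d \<gamma> \<le> ?d (\<rho> {u, v})"
      using assms(1,2,5) by (simp add: edge_density_eq_pair_density)
  qed
  finally have "1 \<le> c * ?d (\<rho> {u, v})" by simp
  then show ?thesis by (cases "c = 0") (auto simp: field_simps)
qed

section \<open>Choice of constants, construction of the clusters and comparison with the
  multiplicity\<close>

theorem theorem5p7: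
  fixes c t :: nat
    and G :: "nat \<Rightarrow> 'a::linorder ordered_graph"
    and lam :: "nat \<Rightarrow> real"
  assumes "c \<ge> 2"
    and "\<forall>i\<in>{1..c}. ordered_graph (G i) \<and> edges (G i) \<noteq> {}"
    and "\<forall>i\<in>{1..c}. lam i > 0"
    and "t \<ge> ordered_ramsey c G"
  shows "let J = {i \<in> {1..c}. num_verts (G i) \<le> t};
             \<delta> = (\<lambda>i. delta (num_verts (G i)) (1 / real c))
         in \<exists>\<epsilon>>0. \<exists>\<alpha>>0. \<exists>n0::nat. \<forall>n\<ge>n0. \<forall>\<chi>\<in>colorings n c. \<exists>W::nat \<Rightarrow> nat set.
              (\<forall>j\<in>{1..t}. W j \<subseteq> {1..n} \<and> real (card (W j)) \<ge> \<alpha> * real n) \<and>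
              (\<forall>u v. 1 \<le> u \<and> u < v \<and> v \<le> t \<longrightarrow>
                 (\<forall>x\<in>W u. \<forall>y\<in>W v. x < y) \<and> regular_pair \<chi> c \<epsilon> (W u) (W v)) \<and>
              (\<forall>\<rho>. reduced_coloring \<chi> c t W \<rho> \<longrightarrow>
                 (\<forall>i\<in>J. real (card (regular_copies \<chi> n W t \<rho> i (G i)))
                    \<ge> \<delta> i * (\<Sum>F\<in>mono_copies \<rho> t i (G i). \<Prod>j\<in>F. real (card (W j)))) \<and>
                 (\<Sum>i\<in>J. lam i * real (card (regular_copies \<chi> n W t \<rho> i (G i)))
                    / (\<delta> i * (\<alpha> * real n) ^ num_verts (G i)))
                   \<ge> ordered_multiplicity lam t c G)"
proof -
  define h where "h i = num_verts (G i)" for i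
  define \<delta> where "\<delta> i = delta (h i) (1 / real c)" for i
  define J where "J = {i \<in> {1..c}. h i \<le> t}"
  have c: "0 < 1 / real c" "1 / real c \<le> 1" using assms(1) by auto
  have "\<forall>i. \<exists>e>0. \<forall>(V :: 'a set) (W :: 'a \<Rightarrow> nat set) E R. finite V \<longrightarrow> card V = h i \<longrightarrow>
     (\<forall>v\<in>V. finite (W v)) \<longrightarrow> (\<forall>e\<in>E. e \<subseteq> V \<and> card e = 2) \<longrightarrow>
     (\<forall>u v. u \<noteq> v \<longrightarrow> {u, v} \<in> E \<longrightarrow> lower_dense R e (1 / real c / 2) (W u) (W v)) \<longrightarrow>
     \<delta> i * (\<Prod>v\<in>V. real (card (W v))) \<le> card (partite_homs R E V W)"
    unfolding \<delta>_def using card_partite_homs_ge[OF c] by blast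
  then obtain e0 where e0: "\<And>i. 0 < e0 i" and count:
    "\<And>i (V :: 'a set) (W :: 'a \<Rightarrow> nat set) E R. finite V \<Longrightarrow> card V = h i \<Longrightarrow>
     (\<forall>v\<in>V. finite (W v)) \<Longrightarrow> (\<forall>e\<in>E. e \<subseteq> V \<and> card e = 2) \<Longrightarrow>
     (\<forall>u v. u \<noteq> v \<longrightarrow> {u, v} \<in> E \<longrightarrow> lower_dense R (e0 i) (1 / real c / 2) (W u) (W v)) \<Longrightarrow>
     \<delta> i * (\<Prod>v\<in>V. real (card (W v))) \<le> card (partite_homs R E V W)"
    by metis
  \<comment> \<open>With \<open>\<epsilon> \<le> 1 / (2 * c)\<close> a majority density of at least
    \<open>1 / c\<close> still leaves half of that after the regularity error;
    \<open>\<epsilon> \<le> e0 i\<close> meets the threshold of the counting bound for every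
    color.\<close>
  define \<epsilon> where "\<epsilon> = Min (insert (1 / (2 * real c)) (e0 ` {1..c}))"
  have \<epsilon>0: "0 < \<epsilon>" using e0 assms(1) by (simp add: \<epsilon>_def)
  have \<epsilon>c: "\<epsilon> \<le> 1 / (2 * real c)" unfolding \<epsilon>_def by (intro Min_le) auto
  have \<epsilon>e: "\<epsilon> \<le> e0 i" if "i \<in> {1..c}" for i unfolding \<epsilon>_def using that by (intro Min_le) auto
  have "1 / (2 * real c) \<le> 1" using assms(1) by simp
  then have \<epsilon>1: "\<epsilon> \<le> 1" using \<epsilon>c by linarith
  \<comment> \<open>The third component is a color, so one application of
    \<open>uniform_subfamily\<close> handles all pairs in all colors.\<close>
  define S where "S = {(u, v, \<gamma>). 1 \<le> u \<and> u < v \<and> v \<le> t \<and> \<gamma> \<in> {1..c}}"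
  have "finite S"
    by (rule finite_subset[of _ "{1..t} \<times> {1..t} \<times> {1..c}"]) (auto simp: S_def)
  moreover have "\<forall>(u, v, q) \<in> S. u \<noteq> v" by (auto simp: S_def)
  ultimately obtain \<beta> :: real where \<beta>: "0 < \<beta>" and fam:
    "\<And>(R :: nat \<Rightarrow> nat set \<Rightarrow> bool) (I :: nat \<Rightarrow> nat set). \<forall>j. finite (I j) \<Longrightarrow>
       \<exists>W. (\<forall>j. W j \<subseteq> I j \<and> \<beta> * card (I j) \<le> card (W j)) \<and>
           (\<forall>(u, v, q) \<in> S. uniform_pair (R q) \<epsilon> (W u) (W v))"
    using uniform_subfamily[OF _ \<epsilon>0 \<epsilon>1, of S] by metis
  \<comment> \<open>The starting intervals will have at least \<open>n / (2 * Suc t)\<close>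
    elements, and refinement keeps a \<open>\<beta>\<close> fraction of each.\<close>
  define \<alpha> where "\<alpha> = \<beta> / (2 * real (Suc t))"
  have \<alpha>: "0 < \<alpha>" using \<beta> by (simp add: \<alpha>_def)
  have main: "\<exists>W::nat \<Rightarrow> nat set.
      (\<forall>j\<in>{1..t}. W j \<subseteq> {1..n} \<and> real (card (W j)) \<ge> \<alpha> * real n) \<and>
      (\<forall>u v. 1 \<le> u \<and> u < v \<and> v \<le> t \<longrightarrow>
         (\<forall>x\<in>W u. \<forall>y\<in>W v. x < y) \<and> regular_pair \<chi> c \<epsilon> (W u) (W v)) \<and>
      (\<forall>\<rho>. reduced_coloring \<chi> c t W \<rho> \<longrightarrow>
         (\<forall>i\<in>J. real (card (regular_copies \<chi> n W t \<rho> i (G i)))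
            \<ge> \<delta> i * (\<Sum>F\<in>mono_copies \<rho> t i (G i). \<Prod>j\<in>F. real (card (W j)))) \<and>
         (\<Sum>i\<in>J. lam i * real (card (regular_copies \<chi> n W t \<rho> i (G i)))
            / (\<delta> i * (\<alpha> * real n) ^ h i))
           \<ge> ordered_multiplicity lam t c G)"
    if n: "n \<ge> Suc t" and \<chi>: "\<chi> \<in> colorings n c" for n \<chi>
  proof -
    \<comment> \<open>Dividing by \<open>Suc t\<close> keeps the divisor positive. As
      \<open>m \<ge> 1\<close>, rounding down costs at most a factor 2.\<close>
    define m where "m = n div Suc t"
    have m1: "1 \<le> m" using n by (simp add: m_def div_greater_zero_iff Suc_le_eq)
    have mn: "Suc t * m \<le> n" unfolding m_def by (rule times_div_less_eq_dividend)
    have "n < Suc t * m + Suc t"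
      using mod_less_divisor[OF zero_less_Suc[of t], of n] mult_div_mod_eq[of "Suc t" n]
      unfolding m_def by linarith
    also have "\<dots> \<le> 2 * (Suc t * m)" using mult_le_mono2[OF m1, of "Suc t"] by (simp add: mult.commute)
    finally have "real n \<le> real (2 * (Suc t * m))" by (intro of_nat_mono) simp
    then have nm: "real n / (2 * real (Suc t)) \<le> m" by (simp add: field_simps)
    have "\<beta> * (real n / (2 * real (Suc t))) \<le> \<beta> * m" using nm \<beta> by (intro mult_left_mono) auto
    then have \<alpha>n: "\<alpha> * n \<le> \<beta> * m" by (simp add: \<alpha>_def)
    have \<alpha>n0: "0 < \<alpha> * n" using \<alpha> n by simp
    \<comment> \<open>Half-open blocks of exactly \<open>m\<close> elements. Truncated subtraction
      makes \<open>I 0\<close> equal to \<open>I 1\<close>; the ordering is claimed from index 1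
      onwards.\<close>
    define I where "I j = {(j - 1) * m<..(j - 1) * m + m}" for j :: nat
    have "\<forall>j. finite (I j)" by (simp add: I_def)
    from fam[OF this, of "\<lambda>q e. \<chi> e = q"] obtain W
      where W: "\<forall>j. W j \<subseteq> I j \<and> \<beta> * card (I j) \<le> card (W j)"
        and WS: "\<forall>(u, v, q) \<in> S. uniform_pair (\<lambda>e. \<chi> e = q) \<epsilon> (W u) (W v)"
      by (elim exE conjE)
    have In: "I j \<subseteq> {1..n}" if j: "j \<in> {1..t}" for j
    proof -
      have "(j - 1) * m + m = j * m" using j by (cases j) auto
      also have "\<dots> \<le> Suc t * m" using j by (intro mult_right_mono) auto
      also note mn
      finally have "{(j - 1) * m<..(j - 1) * m + m} \<subseteq> {1..n}" by (intro subsetI) simp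
      then show ?thesis by (simp only: I_def)
    qed
    have Iless: "x < y" if uv: "1 \<le> u" "u < v" and xy: "x \<in> I u" "y \<in> I v" for u v x y
    proof -
      have "(u - 1) * m + m = u * m" using uv by (cases u) auto
      also have "\<dots> \<le> (v - 1) * m" using uv by (intro mult_right_mono) auto
      finally have "(u - 1) * m + m \<le> (v - 1) * m" .
      moreover have "x \<le> (u - 1) * m + m" "(v - 1) * m < y"
        using xy unfolding I_def by (simp_all only: greaterThanAtMost_iff)
      ultimately show ?thesis by linarith
    qed
    have Wn: "W j \<subseteq> {1..n}" if "j \<in> {1..t}" for j using W In[OF that] by blast
    have finW: "finite (W j)" for j
      using W unfolding I_def by (blast intro: finite_subset finite_greaterThanAtMost)
    have Wcard: "\<alpha> * n \<le> card (W j)" for j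
    proof -
      have "\<beta> * m \<le> card (W j)" using W by (simp add: I_def)
      then show ?thesis using \<alpha>n by linarith
    qed
    have Wne: "W j \<noteq> {}" for j using Wcard[of j] \<alpha>n0 by auto
    have Wless: "x < y" if "1 \<le> u" "u < v" "v \<le> t" "x \<in> W u" "y \<in> W v" for u v x y
      using Iless[of u v x y] W that by blast
    have disj: "W u \<inter> W v = {}" if "1 \<le> u" "u < v" "v \<le> t" for u v
      using Wless[OF that] by fastforce
    have unif: "uniform_pair (\<lambda>e. \<chi> e = \<gamma>) \<epsilon> (W u) (W v)"
      if "1 \<le> u" "u < v" "v \<le> t" "\<gamma> \<in> {1..c}" for u v \<gamma>
      using WS that by (auto simp: S_def)
    have reg: "regular_pair \<chi> c \<epsilon> (W u) (W v)" if "1 \<le> u" "u < v" "v \<le> t" for u v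
      using unif[OF that] disj[OF that] finW by (intro regular_pairI) auto
    have copies: "\<delta> i * (\<Sum>F\<in>mono_copies \<rho> t i (G i). \<Prod>j\<in>F. real (card (W j)))
          \<le> card (regular_copies \<chi> n W t \<rho> i (G i))"
      if \<rho>: "reduced_coloring \<chi> c t W \<rho>" and i: "i \<in> {1..c}" for \<rho> i
    proof -
      let ?M = "mono_copies \<rho> t i (G i)" and ?V = "verts (G i)" and ?E = "edges (G i)"
      have Gi: "ordered_graph (G i)" using assms(2) i by simp
      have "\<forall>F\<in>?M. \<exists>f. order_embedding f (G i) (complete_ograph t) \<and> f ` ?V = F \<and> (\<forall>e\<in>?E. \<rho> (f ` e) = i)"
        by (auto simp: mono_copies_def)
      \<comment> \<open>One embedding is fixed for each reduced copy; it tells which cluster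
        receives which vertex of \<open>G i\<close>.\<close>
      then obtain f where f: "\<And>F. F \<in> ?M \<Longrightarrow> order_embedding (f F) (G i) (complete_ograph t) \<and> f F ` ?V = F"
        and fcol: "\<And>F e. F \<in> ?M \<Longrightarrow> e \<in> ?E \<Longrightarrow> \<rho> (f F ` e) = i"
        by metis
      have ld: "lower_dense (\<lambda>e. \<chi> e = i) (e0 i) (1 / real c / 2) (W u) (W v)"
        if uv: "1 \<le> u" "u < v" "v \<le> t" "\<rho> {u, v} = i" for u v
      proof -
        have "1 / real c \<le> pair_density (\<lambda>e. \<chi> e = i) (W u) (W v)"
          using majority_pair_density[of W u v t n \<chi> c \<rho>] finW Wne disj[OF uv(1-3)] Wn uv \<chi> \<rho> by auto
        then have "lower_dense (\<lambda>e. \<chi> e = i) \<epsilon> (1 / real c - \<epsilon>) (W u) (W v)"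
          using unif[OF uv(1-3) i] by (intro uniform_imp_lower_dense) auto
        \<comment> \<open>Half of the majority density is what the counting bound with
          \<open>d = 1 / c\<close> asks of each pair.\<close>
        moreover have "1 / real c / 2 \<le> 1 / real c - \<epsilon>" using \<epsilon>c by (simp add: field_simps)
        ultimately show ?thesis using \<epsilon>e[OF i] lower_dense_mono by blast
      qed
      have F: "\<delta> i * (\<Prod>j\<in>F. real (card (W j)))
          \<le> card (partite_homs (\<lambda>e. \<chi> e = i) ?E ?V (\<lambda>v. W (f F v)))" if FM: "F \<in> ?M" for F
      proof -
        have inj: "inj_on (f F) ?V" and ft: "\<And>v. v \<in> ?V \<Longrightarrow> f F v \<in> {1..t}" and fV: "f F ` ?V = F"
          using f[OF FM] by (auto simp: order_embedding_def complete_ograph_def)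
        have "\<delta> i * (\<Prod>v\<in>?V. real (card (W (f F v))))
            \<le> card (partite_homs (\<lambda>e. \<chi> e = i) ?E ?V (\<lambda>v. W (f F v)))"
        proof (rule count)
          show "\<forall>u v. u \<noteq> v \<longrightarrow> {u, v} \<in> ?E \<longrightarrow>
              lower_dense (\<lambda>e. \<chi> e = i) (e0 i) (1 / real c / 2) (W (f F u)) (W (f F v))"
          proof (intro allI impI)
            fix u v assume uv: "u \<noteq> v" "{u, v} \<in> ?E"
            then have V: "u \<in> ?V" "v \<in> ?V" using Gi by (auto simp: ordered_graph_def)
            have col: "\<rho> {f F u, f F v} = i" using fcol[OF FM uv(2)] by simp
            have ne: "f F u \<noteq> f F v" using inj V uv(1) by (auto dest: inj_onD)
            show "lower_dense (\<lambda>e. \<chi> e = i) (e0 i) (1 / real c / 2) (W (f F u)) (W (f F v))"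
            \<comment> \<open>Edges are unordered whereas \<open>ld\<close> speaks of increasing
              indices, hence the symmetry of \<open>lower_dense\<close>.\<close>
            proof (cases "f F u < f F v")
              case True
              then show ?thesis using ld[of "f F u" "f F v"] ft[OF V(1)] ft[OF V(2)] col by simp
            next
              case False
              then have "f F v < f F u" using ne by simp
              then show ?thesis
                using ld[of "f F v" "f F u"] ft[OF V(1)] ft[OF V(2)] col
                by - (rule lower_dense_commute, simp add: insert_commute)
            qed
          qed
        qed (use Gi finW in \<open>auto simp: ordered_graph_def h_def num_verts_def\<close>)
        moreover have "(\<Prod>j\<in>F. real (card (W j))) = (\<Prod>v\<in>?V. real (card (W (f F v))))"
          using prod.reindex[OF inj, of "\<lambda>j. real (card (W j))"] fV by simp
        ultimately show ?thesis by simp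
      qed
      have "\<delta> i * (\<Sum>F\<in>?M. \<Prod>j\<in>F. real (card (W j)))
          \<le> (\<Sum>F\<in>?M. real (card (partite_homs (\<lambda>e. \<chi> e = i) ?E ?V (\<lambda>v. W (f F v)))))"
        unfolding sum_distrib_left by (intro sum_mono F)
      also have "\<dots> \<le> card (regular_copies \<chi> n W t \<rho> i (G i))"
        using sum_partite_homs_le_regular_copies[OF Gi Wn Wless f, where \<chi> = \<chi>]
        by (simp flip: of_nat_sum)
      finally show ?thesis .
    qed
    \<comment> \<open>The reduced coloring is itself a competitor in the minimum over colorings of
      the complete graph on \<open>t\<close> vertices, and each reduced copy accounts for at least
      \<open>\<delta> i * (\<alpha> * n) ^ h i\<close> copies under \<open>\<chi>\<close>.\<close>
    have mult: "ordered_multiplicity lam t c G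
        \<le> (\<Sum>i\<in>J. lam i * real (card (regular_copies \<chi> n W t \<rho> i (G i))) / (\<delta> i * (\<alpha> * real n) ^ h i))"
      if \<rho>: "reduced_coloring \<chi> c t W \<rho>" for \<rho>
    proof -
      have "\<rho> \<in> colorings t c" using \<rho> by (simp add: reduced_coloring_def)
      then have "ordered_multiplicity lam t c G \<le> (\<Sum>i\<in>{1..c}. lam i * real (card (mono_copies \<rho> t i (G i))))"
        by (rule ordered_multiplicity_le)
      \<comment> \<open>A graph with more than \<open>t\<close> vertices has no reduced copy, so
        colors outside \<open>J\<close> contribute 0.\<close>
      also have "\<dots> = (\<Sum>i\<in>J. lam i * real (card (mono_copies \<rho> t i (G i))))"
      proof (rule sum.mono_neutral_right)
        show "\<forall>i\<in>{1..c} - J. lam i * real (card (mono_copies \<rho> t i (G i))) = 0"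
        proof
          fix i assume "i \<in> {1..c} - J"
          then have "t < num_verts (G i)" by (auto simp: J_def h_def)
          then show "lam i * real (card (mono_copies \<rho> t i (G i))) = 0"
            by (simp add: mono_copies_eq_empty)
        qed
      qed (auto simp: J_def)
      also have "\<dots> \<le> (\<Sum>i\<in>J. lam i * real (card (regular_copies \<chi> n W t \<rho> i (G i))) / (\<delta> i * (\<alpha> * real n) ^ h i))"
      proof (rule sum_mono)
        fix i assume "i \<in> J"
        then have i: "i \<in> {1..c}" by (simp add: J_def)
        let ?M = "mono_copies \<rho> t i (G i)" and ?T = "real (card (regular_copies \<chi> n W t \<rho> i (G i)))"
        have \<delta>i: "0 < \<delta> i" unfolding \<delta>_def by (rule delta_pos[OF c(1)])
        have D: "0 < \<delta> i * (\<alpha> * n) ^ h i" using \<delta>i \<alpha>n0 by simp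
        have "(\<alpha> * n) ^ h i \<le> (\<Prod>j\<in>F. real (card (W j)))" if "F \<in> ?M" for F
        proof -
          have "(\<alpha> * n) ^ h i = (\<Prod>j\<in>F. \<alpha> * n)"
            using card_mono_copies_elem[OF that] by (simp add: h_def)
          also have "\<dots> \<le> (\<Prod>j\<in>F. real (card (W j)))"
            using Wcard \<alpha>n0 by (intro prod_mono) auto
          finally show ?thesis .
        qed
        then have "(\<Sum>F\<in>?M. (\<alpha> * n) ^ h i) \<le> (\<Sum>F\<in>?M. \<Prod>j\<in>F. real (card (W j)))"
          by (rule sum_mono)
        then have "\<delta> i * (card ?M * (\<alpha> * n) ^ h i) \<le> \<delta> i * (\<Sum>F\<in>?M. \<Prod>j\<in>F. real (card (W j)))"
          using \<delta>i by (intro mult_left_mono) auto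
        also have "\<dots> \<le> ?T" by (rule copies[OF \<rho> i])
        finally have "card ?M * (\<delta> i * (\<alpha> * n) ^ h i) \<le> ?T" by (simp add: mult.left_commute)
        then have "card ?M \<le> ?T / (\<delta> i * (\<alpha> * n) ^ h i)" using D by (simp only: pos_le_divide_eq)
        then have "lam i * card ?M \<le> lam i * (?T / (\<delta> i * (\<alpha> * n) ^ h i))"
          using bspec[OF assms(3) i] by (intro mult_left_mono) auto
        then show "lam i * card ?M \<le> lam i * ?T / (\<delta> i * (\<alpha> * n) ^ h i)" by simp
      qed
      finally show ?thesis .
    qed
    have Jc: "i \<in> {1..c}" if "i \<in> J" for i using that by (simp add: J_def)
    show ?thesis
    proof (intro exI[of _ W] conjI ballI allI impI)
      fix \<rho> i assume "reduced_coloring \<chi> c t W \<rho>" "i \<in> J"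
      then show "\<delta> i * (\<Sum>F\<in>mono_copies \<rho> t i (G i). \<Prod>j\<in>F. real (card (W j)))
          \<le> card (regular_copies \<chi> n W t \<rho> i (G i))"
        using copies Jc by simp
    qed (use Wn Wcard Wless reg mult in \<open>blast+\<close>)
  qed
  show ?thesis
    unfolding Let_def
    using \<epsilon>0 \<alpha> main unfolding J_def \<delta>_def h_def
    by (intro exI[of _ \<epsilon>] exI[of _ \<alpha>] exI[of _ "Suc t"] conjI allI impI ballI)
qed

end
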